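(* Let $X=(X_1,\dots,X_d)$ be a random vector in $\mathbb{R}^d$ such that $\mathbb{E}|X_i|<+\infty$ for all $i\in\{1,\dots,d\}$. Let $\nu$ be a Lévy measure on $\mathbb{R}^d$ such that $\int_{\|u\|\ge 1}\|u\|\,\nu(du)<+\infty$. Then $$\mathbb{E}\,Xf(X)=\mathbb{E}X\;\mathbb{E}f(X)+\mathbb{E}\int_{\mathbb{R}^d}\big(f(X+u)-f(X)\big)\,u\,\nu(du)$$ holds (as an equality in $\mathbb{R}^d$) for all bounded Lipschitz functions $f:\mathbb{R}^d\to\mathbb{R}$ if and only if $X$ is infinitely divisible with triplet $(b,0,\nu)$, where $b=\mathbb{E}X-\int_{\|u\|>1}u\,\nu(du)$.
   Context: $\|\cdot\|$ and $\langle\cdot;\cdot\rangle$ are the Euclidean norm and inner product on $\mathbb{R}^d$, $d\ge1$. A Lévy measure is a positive Borel measure $\nu$ on $\mathbb{R}^d$ with $\nu(\{0\})=0$ and $\int_{\mathbb{R}^d}(1\wedge\|u\|^2)\nu(du)<+\infty$. A random vector $X$ is infinitely divisible (ID) with triplet $(b,\Sigma,\nu)$, written $X\sim ID(b,\Sigma,\nu)$, if its characteristic function is $\varphi(\xi)=\exp\big(i\langle b;\xi\rangle-\frac12\langle\xi;\Sigma\xi\rangle+\int_{\mathbb{R}^d}(e^{i\langle\xi;u\rangle}-1-i\langle\xi;u\rangle\mathbf 1_{\|u\|\le1})\nu(du)\big)$, with $b\in\mathbb{R}^d$, $\Sigma$ a symmetric positive semi-definite $d\times d$ matrix and $\nu$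 a Lévy measure. *)

theory Defs
  imports "HOL-Probability.Probability"
begin

text \<open>The space \<open>real ^ 'd\<close> has dimension \<open>CARD('d) \<ge> 1\<close>.\<close>

definition levy_measure :: "(real ^ 'd::finite) measure \<Rightarrow> bool" where
  "levy_measure \<nu> \<longleftrightarrow>
     sets \<nu> = sets borel \<and>
     emeasure \<nu> {0} = 0 \<and>
     (\<integral>\<^sup>+ u. ennreal (min 1 ((norm u)\<^sup>2)) \<partial>\<nu>) < \<infinity>"

text \<open>The multivariate analogue of \<^const>\<open>char\<close>, which the library provides for
  measures on the real line only.\<close>

definition vec_char :: "(real ^ 'd::finite) measure \<Rightarrow> real ^ 'd \<Rightarrow> complex" where
  "vec_char \<mu> \<xi> = (CLINT x | \<mu>. iexp (\<xi> \<bullet> x))"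

definition levy_khintchine_exponent ::
    "real ^ 'd::finite \<Rightarrow> real ^ 'd ^ 'd \<Rightarrow> (real ^ 'd) measure \<Rightarrow> real ^ 'd \<Rightarrow> complex" where
  "levy_khintchine_exponent b \<Sigma> \<nu> \<xi> =
     \<i> * complex_of_real (b \<bullet> \<xi>)
     - (1 / 2) * complex_of_real (\<xi> \<bullet> (\<Sigma> *v \<xi>))
     + (CLINT u | \<nu>. iexp (\<xi> \<bullet> u) - 1
          - \<i> * complex_of_real (\<xi> \<bullet> u) * indicator {v. norm v \<le> 1} u)"

text \<open>The relation \<open>X \<sim> ID(b, \<Sigma>, \<nu>)\<close> for a random vector \<open>X\<close> on \<open>M\<close>. It is
  defined by the form of the characteristic function, not by the existence of
  convolution roots of the law of \<open>X\<close>.\<close>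

definition infinitely_divisible_with_triplet ::
    "'a measure \<Rightarrow> ('a \<Rightarrow> real ^ 'd::finite) \<Rightarrow>
     real ^ 'd \<Rightarrow> real ^ 'd ^ 'd \<Rightarrow> (real ^ 'd) measure \<Rightarrow> bool" where
  "infinitely_divisible_with_triplet M X b \<Sigma> \<nu> \<longleftrightarrow>
     transpose \<Sigma> = \<Sigma> \<and>
     (\<forall>x. 0 \<le> x \<bullet> (\<Sigma> *v x)) \<and>
     levy_measure \<nu> \<and>
     (\<forall>\<xi>. vec_char (distr M borel X) \<xi> = exp (levy_khintchine_exponent b \<Sigma> \<nu> \<xi>))"

end

theory Submission
  imports Defs
begin

text \<open>
  The identity is linear in \<open>f\<close>. For \<open>f\<close> a character \<open>exp (i \<xi> \<cdot> x)\<close> the jump term factorises, and the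
  identity says that the derivative of the characteristic function at \<open>\<xi>\<close>, in every direction, equals the
  characteristic function times the derivative of the Levy-Khintchine exponent. If this holds for every
  \<open>\<xi>\<close>, integrating it along rays from \<open>0\<close> shows that \<open>X\<close> is infinitely divisible; conversely,
  differentiating the Levy-Khintchine formula gives the identity for characters.

  The identity passes to integral mixtures of test functions by Fubini, and to pointwise limits that are
  uniformly bounded and uniformly Lipschitz by dominated convergence. A Gaussian bump is a mixture of
  characters, so the convolution of a compactly supported \<open>f\<close> with a Gaussian kernel is covered; it has the
  bounds of \<open>f\<close> and tends to \<open>f\<close> as the kernel shrinks. Cut-offs remove the restriction on the support.
\<close>

section \<open>Bounded Lipschitz functions with explicit constants\<close>

text \<open>Both constants are parameters because limits require them to be uniform along a
  sequence, and mixtures integrate them against the mixing measure.\<close>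

definition bounded_lipschitz :: "real \<Rightarrow> real \<Rightarrow> ('b::real_normed_vector \<Rightarrow> real) \<Rightarrow> bool" where
  "bounded_lipschitz B L f \<longleftrightarrow> (\<forall>x. \<bar>f x\<bar> \<le> B) \<and> L-lipschitz_on UNIV f"

lemma bounded_lipschitzI:
  assumes "\<And>x. \<bar>f x\<bar> \<le> B" "0 \<le> L" "\<And>x y. \<bar>f x - f y\<bar> \<le> L * norm (x - y)"
  shows "bounded_lipschitz B L f"
  using assms by (auto simp: bounded_lipschitz_def lipschitz_on_def dist_norm)

lemma bounded_lipschitzD:
  assumes "bounded_lipschitz B L f"
  shows "\<bar>f x\<bar> \<le> B" "\<bar>f x - f y\<bar> \<le> L * norm (x - y)" "0 \<le> B" "0 \<le> L"
proof -
  show "\<bar>f x\<bar> \<le> B" for x using assms by (auto simp: bounded_lipschitz_def)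
  from this[of undefined] show "0 \<le> B" by simp
qed (use assms in \<open>auto simp: bounded_lipschitz_def lipschitz_on_def dist_norm\<close>)

lemma bounded_lipschitz_measurable:
  fixes f :: "'b::real_normed_vector \<Rightarrow> real"
  assumes "bounded_lipschitz B L f"
  shows "f \<in> borel_measurable borel"
  using assms
  by (auto simp: bounded_lipschitz_def
      intro!: borel_measurable_continuous_onI lipschitz_on_continuous_on)

text \<open>Boundedness controls large jumps and the Lipschitz property small ones;
  \<open>2 * B + L\<close> serves both ranges. Multiplied by \<open>norm u\<close>, the right-hand
  side becomes a function integrable under the two moment conditions on \<nu>.\<close>

lemma bounded_lipschitz_increment:
  assumes "bounded_lipschitz B L f"
  shows "\<bar>f (x + u) - f x\<bar> \<le> (2 * B + L) * min 1 (norm u)"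
proof -
  note D = bounded_lipschitzD[OF assms]
  have 1: "\<bar>f (x + u) - f x\<bar> \<le> 2 * B" using D(1)[of x] D(1)[of "x + u"] by linarith
  have 2: "\<bar>f (x + u) - f x\<bar> \<le> L * norm u" using D(2)[of "x + u" x] by simp
  show ?thesis
  proof (cases "norm u \<le> 1")
    case True
    have "L * norm u \<le> (2 * B + L) * norm u" using D(3) by (intro mult_right_mono) auto
    then show ?thesis using 2 True by simp
  next
    case False
    then show ?thesis using 1 D(4) by simp
  qed
qed

lemma bounded_lipschitz_add:
  assumes "bounded_lipschitz B L f" "bounded_lipschitz B' L' g"
  shows "bounded_lipschitz (\<bar>a\<bar> * B + \<bar>b\<bar> * B') (\<bar>a\<bar> * L + \<bar>b\<bar> * L') (\<lambda>x. a * f x + b * g x)"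
proof (rule bounded_lipschitzI)
  note F = bounded_lipschitzD[OF assms(1)] and G = bounded_lipschitzD[OF assms(2)]
  show "0 \<le> \<bar>a\<bar> * L + \<bar>b\<bar> * L'" using F(4) G(4) by simp
  show "\<bar>a * f x + b * g x\<bar> \<le> \<bar>a\<bar> * B + \<bar>b\<bar> * B'" for x
    by (rule order_trans[OF abs_triangle_ineq])
      (auto simp: abs_mult intro!: add_mono mult_left_mono F G)
  show "\<bar>(a * f x + b * g x) - (a * f y + b * g y)\<bar> \<le> (\<bar>a\<bar> * L + \<bar>b\<bar> * L') * norm (x - y)" for x y
  proof -
    have "(a * f x + b * g x) - (a * f y + b * g y) = a * (f x - f y) + b * (g x - g y)"
      by (simp add: algebra_simps)
    also have "\<bar>\<dots>\<bar> \<le> \<bar>a\<bar> * \<bar>f x - f y\<bar> + \<bar>b\<bar> * \<bar>g x - g y\<bar>"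
      by (rule order_trans[OF abs_triangle_ineq]) (simp add: abs_mult)
    also have "\<dots> \<le> \<bar>a\<bar> * (L * norm (x - y)) + \<bar>b\<bar> * (L' * norm (x - y))"
      by (intro add_mono mult_left_mono F G) auto
    finally show ?thesis by (simp add: algebra_simps)
  qed
qed

section \<open>Integrability and sigma-finiteness of the Levy measure\<close>

locale stein = prob_space M for M :: "'a measure" +
  fixes X :: "'a \<Rightarrow> real ^ 'd::finite"
    and \<nu> :: "(real ^ 'd) measure"
  assumes X_measurable [measurable]: "X \<in> borel_measurable M"
    and X_integrable: "integrable M X"
    and levy: "levy_measure \<nu>"
    and first_moment: "(\<integral>\<^sup>+ u \<in> {u. 1 \<le> norm u}. ennreal (norm u) \<partial>\<nu>) < \<infinity>"
begin

lemma sets_nu [measurable_cong]: "sets \<nu> = sets borel"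
  using levy by (simp add: levy_measure_def)

lemma space_nu [simp]: "space \<nu> = UNIV"
  using sets_eq_imp_space_eq[OF sets_nu] by simp

text \<open>This is the square of the norm on the unit ball and the norm itself outside, the growth
  that the Levy condition and the first moment of the tail make integrable. Multiples of it dominate
  the integrands over \<nu> throughout.\<close>

definition weight :: "real ^ 'd \<Rightarrow> real" where
  "weight u = norm u * min 1 (norm u)"

lemma weight_nonneg [simp]: "0 \<le> weight u"
  by (simp add: weight_def)

lemma weight_measurable [measurable]: "weight \<in> borel_measurable borel"
  unfolding weight_def by measurable

lemma integrable_min: "integrable \<nu> (\<lambda>u. min 1 ((norm u)\<^sup>2))"
  using levy by (intro integrableI_bounded) (auto simp: levy_measure_def)

lemma integrable_tail: "integrable \<nu> (\<lambda>u. norm u * indicator {u. 1 \<le> norm u} u)"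
proof (rule integrableI_bounded)
  have "(\<integral>\<^sup>+ u. ennreal (norm (norm u * indicator {u. 1 \<le> norm u} u)) \<partial>\<nu>)
      = (\<integral>\<^sup>+ u \<in> {u. 1 \<le> norm u}. ennreal (norm u) \<partial>\<nu>)"
    by (intro nn_integral_cong) (auto simp: indicator_def)
  then show "(\<integral>\<^sup>+ u. ennreal (norm (norm u * indicator {u. 1 \<le> norm u} u)) \<partial>\<nu>) < \<infinity>"
    using first_moment by simp
qed measurable

lemma integrable_weight: "integrable \<nu> weight"
proof (rule Bochner_Integration.integrable_bound)
  show "integrable \<nu> (\<lambda>u. min 1 ((norm u)\<^sup>2) + norm u * indicator {u. 1 \<le> norm u} u)"
    by (intro Bochner_Integration.integrable_add integrable_min integrable_tail)
  show "AE u in \<nu>. norm (weight u)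
      \<le> norm (min 1 ((norm u)\<^sup>2) + norm u * indicator {u. 1 \<le> norm u} u)"
  proof (intro AE_I2)
    fix u
    have "weight u \<le> min 1 ((norm u)\<^sup>2) + norm u * indicator {u. 1 \<le> norm u} u"
    proof (cases "norm u < 1")
      case True
      then have "norm u * norm u \<le> 1" by (intro mult_le_one) auto
      then show ?thesis using True by (simp add: weight_def power2_eq_square)
    qed (simp add: weight_def)
    then show "norm (weight u) \<le> norm (min 1 ((norm u)\<^sup>2) + norm u * indicator {u. 1 \<le> norm u} u)"
      by simp
  qed
qed measurable

lemma integrable_weight_bound:
  fixes g :: "real ^ 'd \<Rightarrow> 'b::{banach, second_countable_topology}"
  assumes "g \<in> borel_measurable borel" "\<And>u. norm (g u) \<le> c * weight u"
  shows "integrable \<nu> g"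
proof (rule Bochner_Integration.integrable_bound)
  show "integrable \<nu> (\<lambda>u. c * weight u)" using integrable_weight by simp
  show "g \<in> borel_measurable \<nu>" using assms(1) by measurable
  show "AE u in \<nu>. norm (g u) \<le> norm (c * weight u)"
    using assms(2) by (auto intro: order_trans[OF _ abs_ge_self])
qed

text \<open>Fubini and the measurability of parametrised integrals need this. The complement of each
  small ball around the origin has finite mass by Markov's inequality; these sets and the null set
  \<open>{0}\<close> cover the space.\<close>

lemma sigma_finite_nu: "sigma_finite_measure \<nu>"
proof
  define A where "A n = {u::real ^ 'd. 1 \<le> real (Suc n) * norm u}" for n
  have [measurable]: "A n \<in> sets borel" for n unfolding A_def by measurable
  have fin: "emeasure \<nu> (A n) < \<infinity>" for n
  proof -
    \<comment> \<open>The set is brought into the form that Markov's inequality expects. Truncating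
      the square at 1 changes nothing, since the factor in front is at least 1.\<close>
    have "A n = {u \<in> UNIV. 1 \<le> ennreal ((real (Suc n))\<^sup>2) * ennreal (min 1 ((norm u)\<^sup>2))}"
    proof -
      have "1 \<le> real (Suc n) * norm u \<longleftrightarrow> 1 \<le> (real (Suc n))\<^sup>2 * min 1 ((norm u)\<^sup>2)" for u :: "real ^ 'd"
      proof -
        have "1 \<le> real (Suc n) * norm u \<longleftrightarrow> 1\<^sup>2 \<le> (real (Suc n) * norm u)\<^sup>2"
          by (subst abs_le_square_iff[symmetric]) simp
        also have "\<dots> \<longleftrightarrow> 1 \<le> (real (Suc n))\<^sup>2 * min 1 ((norm u)\<^sup>2)"
        proof (cases "(norm u)\<^sup>2 \<le> 1")
          case False
          have *: "1 \<le> (real (Suc n))\<^sup>2" by simp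
          then have "1 * 1 \<le> (real (Suc n))\<^sup>2 * (norm u)\<^sup>2" using False by (intro mult_mono) auto
          then show ?thesis using * False by (simp add: power_mult_distrib min_def)
        qed (simp add: power_mult_distrib min_def)
        finally show ?thesis .
      qed
      then show ?thesis unfolding A_def
        by (simp flip: ennreal_mult' ennreal_1 add: ennreal_le_iff)
    qed
    then have "emeasure \<nu> (A n) \<le> ennreal ((real (Suc n))\<^sup>2)
        * (\<integral>\<^sup>+ u. ennreal (min 1 ((norm u)\<^sup>2)) * indicator UNIV u \<partial>\<nu>)"
      using sets_nu by (simp only:) (rule nn_integral_Markov_inequality, auto)
    also have "\<dots> < \<infinity>"
      using levy by (auto simp: levy_measure_def ennreal_mult_less_top)
    finally show ?thesis .
  qed
  have cover: "(\<Union>n. A n) \<union> {0} = UNIV"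
  proof safe
    fix u :: "real ^ 'd" assume *: "u \<notin> (\<Union>n. A n)"
    show "u = 0"
    proof (rule ccontr)
      assume "u \<noteq> 0"
      then obtain n where "1 < real n * norm u" using reals_Archimedean3[of "norm u"] by auto
      moreover have "real n * norm u \<le> real (Suc n) * norm u" by (intro mult_right_mono) auto
      ultimately have "u \<in> A n" unfolding A_def mem_Collect_eq by linarith
      then show False using * by auto
    qed
  qed auto
  show "\<exists>B. countable B \<and> B \<subseteq> sets \<nu> \<and> \<Union> B = space \<nu> \<and> (\<forall>a\<in>B. emeasure \<nu> a \<noteq> \<infinity>)"
  proof (intro exI[of _ "insert {0} (range A)"] conjI ballI)
    show "insert {0} (range A) \<subseteq> sets \<nu>" by (auto simp: sets_nu)
    show "\<Union> (insert {0} (range A)) = space \<nu>" using cover by simp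
    fix a assume "a \<in> insert {0} (range A)"
    then show "emeasure \<nu> a \<noteq> \<infinity>" using less_imp_neq[OF fin] levy by (auto simp: levy_measure_def)
  qed auto
qed

sublocale nu: sigma_finite_measure \<nu>
  by (rule sigma_finite_nu)

section \<open>The identity and the integrability of its terms\<close>

definition jump :: "(real ^ 'd \<Rightarrow> real) \<Rightarrow> real ^ 'd \<Rightarrow> real ^ 'd" where
  "jump f x = (\<integral>u. (f (x + u) - f x) *\<^sub>R u \<partial>\<nu>)"

text \<open>Test functions are real, so a complex character enters through its real and imaginary
  parts, a cosine and a sine.\<close>

definition stein_eq :: "(real ^ 'd \<Rightarrow> real) \<Rightarrow> bool" where
  "stein_eq f \<longleftrightarrow>
     (\<integral>\<omega>. f (X \<omega>) *\<^sub>R X \<omega> \<partial>M) =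
       (\<integral>\<omega>. f (X \<omega>) \<partial>M) *\<^sub>R (\<integral>\<omega>. X \<omega> \<partial>M) + (\<integral>\<omega>. jump f (X \<omega>) \<partial>M)"

lemma increment_bound:
  fixes u :: "real ^ 'd"
  assumes "bounded_lipschitz B L f"
  shows "norm ((f (x + u) - f x) *\<^sub>R u) \<le> (2 * B + L) * weight u"
  using mult_right_mono[OF bounded_lipschitz_increment[OF assms, of x u] norm_ge_zero[of u]]
  by (simp add: weight_def mult_ac)

lemma integrable_increment:
  assumes "bounded_lipschitz B L f"
  shows "integrable \<nu> (\<lambda>u. (f (x + u) - f x) *\<^sub>R u)"
  using bounded_lipschitz_measurable[OF assms] increment_bound[OF assms]
  by (intro integrable_weight_bound) auto

lemma jump_measurable [measurable (raw)]:
  assumes [measurable]: "f \<in> borel_measurable borel" "g \<in> borel_measurable N"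
  shows "(\<lambda>x. jump f (g x)) \<in> borel_measurable N"
  unfolding jump_def by measurable

text \<open>The bound does not depend on \<open>x\<close>. Hence the jump term is integrable over
  the probability space, and a constant dominates it when limits are taken.\<close>

lemma norm_jump_le:
  assumes "bounded_lipschitz B L f"
  shows "norm (jump f x) \<le> (2 * B + L) * (\<integral>u. weight u \<partial>\<nu>)"
proof -
  have "norm (jump f x) \<le> (\<integral>u. (2 * B + L) * weight u \<partial>\<nu>)"
    unfolding jump_def
    using increment_bound[OF assms] integrable_weight integrable_increment[OF assms]
    by (intro order_trans[OF integral_norm_bound] integral_mono integrable_norm) auto
  then show ?thesis by simp
qed

lemma integrable_jump:
  assumes "bounded_lipschitz B L f"
  shows "integrable M (\<lambda>\<omega>. jump f (X \<omega>))"
  using bounded_lipschitz_measurable[OF assms] norm_jump_le[OF assms]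
  by (intro integrable_const_bound[where B = "(2 * B + L) * (\<integral>u. weight u \<partial>\<nu>)"]) auto

lemma integrable_comp:
  assumes "bounded_lipschitz B L f"
  shows "integrable M (\<lambda>\<omega>. f (X \<omega>))"
  using bounded_lipschitz_measurable[OF assms] bounded_lipschitzD[OF assms]
  by (intro integrable_const_bound[where B = B]) auto

lemma integrable_comp_scale:
  assumes "bounded_lipschitz B L f"
  shows "integrable M (\<lambda>\<omega>. f (X \<omega>) *\<^sub>R X \<omega>)"
proof (rule Bochner_Integration.integrable_bound)
  note D = bounded_lipschitzD[OF assms]
  show "integrable M (\<lambda>\<omega>. B *\<^sub>R X \<omega>)" using X_integrable by simp
  show "AE \<omega> in M. norm (f (X \<omega>) *\<^sub>R X \<omega>) \<le> norm (B *\<^sub>R X \<omega>)"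
    using D by (auto intro!: mult_right_mono)
  show "(\<lambda>\<omega>. f (X \<omega>) *\<^sub>R X \<omega>) \<in> borel_measurable M"
    using bounded_lipschitz_measurable[OF assms] by measurable
qed

section \<open>Closure under linear combinations, limits and mixtures\<close>

lemma stein_eq_add:
  assumes "stein_eq f" "stein_eq g" "bounded_lipschitz B L f" "bounded_lipschitz B' L' g"
  shows "stein_eq (\<lambda>x. a * f x + b * g x)"
proof -
  have "jump (\<lambda>x. a * f x + b * g x) x = a *\<^sub>R jump f x + b *\<^sub>R jump g x" for x
  proof -
    have "jump (\<lambda>x. a * f x + b * g x) x
        = (\<integral>u. a *\<^sub>R ((f (x + u) - f x) *\<^sub>R u) + b *\<^sub>R ((g (x + u) - g x) *\<^sub>R u) \<partial>\<nu>)"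
      unfolding jump_def
      by (intro Bochner_Integration.integral_cong) (auto simp: algebra_simps)
    also have "\<dots> = a *\<^sub>R jump f x + b *\<^sub>R jump g x"
      unfolding jump_def using integrable_increment[OF assms(3)] integrable_increment[OF assms(4)]
      by (simp del: scaleR_scaleR)
    finally show ?thesis .
  qed
  moreover note integrable_comp[OF assms(3)] integrable_comp[OF assms(4)]
    integrable_comp_scale[OF assms(3)] integrable_comp_scale[OF assms(4)]
    integrable_jump[OF assms(3)] integrable_jump[OF assms(4)]
  ultimately show ?thesis
    using assms(1,2) unfolding stein_eq_def
    by (simp add: scaleR_add_left scaleR_add_right flip: scaleR_scaleR)
qed

text \<open>Uniform constants provide a dominating function for each term, so pointwise convergence
  suffices. The jump term takes two passes: over \<nu> at fixed \<open>x\<close>, then over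
  \<open>M\<close>.\<close>

lemma stein_eq_lim:
  assumes F: "\<And>n. bounded_lipschitz B L (F n)" and S: "\<And>n. stein_eq (F n)"
    and lim: "\<And>x. (\<lambda>n. F n x) \<longlonglongrightarrow> f x"
  shows "stein_eq f"
proof -
  note D = bounded_lipschitzD[OF F]
  have Fm [measurable]: "F n \<in> borel_measurable borel" for n
    by (rule bounded_lipschitz_measurable[OF F])
  have [measurable]: "f \<in> borel_measurable borel"
    by (rule borel_measurable_LIMSEQ_real[OF lim]) simp_all
  have 1: "(\<lambda>n. \<integral>\<omega>. F n (X \<omega>) *\<^sub>R X \<omega> \<partial>M) \<longlonglongrightarrow> (\<integral>\<omega>. f (X \<omega>) *\<^sub>R X \<omega> \<partial>M)"
    using X_integrable D(1)
    by (intro integral_dominated_convergence[where w = "\<lambda>\<omega>. B * norm (X \<omega>)"])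
      (auto intro!: tendsto_intros lim mult_right_mono)
  have 2: "(\<lambda>n. \<integral>\<omega>. F n (X \<omega>) \<partial>M) \<longlonglongrightarrow> (\<integral>\<omega>. f (X \<omega>) \<partial>M)"
    using D(1) by (intro integral_dominated_convergence[where w = "\<lambda>\<omega>. B"])
      (auto intro!: tendsto_intros lim)
  have 3: "(\<lambda>n. jump (F n) x) \<longlonglongrightarrow> jump f x" for x
    unfolding jump_def using integrable_weight increment_bound[OF F]
    by (intro integral_dominated_convergence[where w = "\<lambda>u. (2 * B + L) * weight u"])
      (auto intro!: tendsto_intros lim)
  have 4: "(\<lambda>n. \<integral>\<omega>. jump (F n) (X \<omega>) \<partial>M) \<longlonglongrightarrow> (\<integral>\<omega>. jump f (X \<omega>) \<partial>M)"
    using norm_jump_le[OF F]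
    by (intro integral_dominated_convergence[where w = "\<lambda>\<omega>. (2 * B + L) * (\<integral>u. weight u \<partial>\<nu>)"])
      (auto intro!: 3)
  have "(\<lambda>n. \<integral>\<omega>. F n (X \<omega>) *\<^sub>R X \<omega> \<partial>M)
      \<longlonglongrightarrow> (\<integral>\<omega>. f (X \<omega>) \<partial>M) *\<^sub>R (\<integral>\<omega>. X \<omega> \<partial>M) + (\<integral>\<omega>. jump f (X \<omega>) \<partial>M)"
    using S unfolding stein_eq_def by (simp only:) (intro tendsto_intros 2 4)
  then show ?thesis unfolding stein_eq_def using 1 LIMSEQ_unique by blast
qed

text \<open>Fubini applies because the bounds on \<open>K s\<close> are integrable in
  \<open>s\<close>. The mixing measure is only sigma-finite, so that both a Gaussian law and
  Lebesgue measure can take its place.\<close>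

lemma
  fixes S :: "'s measure" and K :: "'s \<Rightarrow> real ^ 'd \<Rightarrow> real"
  assumes "sigma_finite_measure S"
    and Km [measurable]: "(\<lambda>(s, x). K s x) \<in> borel_measurable (S \<Otimes>\<^sub>M borel)"
    and B: "integrable S B" and L: "integrable S L"
    and K: "\<And>s. s \<in> space S \<Longrightarrow> bounded_lipschitz (B s) (L s) (K s)"
  shows bounded_lipschitz_mixture:
      "bounded_lipschitz (\<integral>s. B s \<partial>S) (\<integral>s. L s \<partial>S) (\<lambda>x. \<integral>s. K s x \<partial>S)" (is ?lip)
    and stein_eq_mixture:
      "(\<And>s. s \<in> space S \<Longrightarrow> stein_eq (K s)) \<Longrightarrow> stein_eq (\<lambda>x. \<integral>s. K s x \<partial>S)"
proof -
  interpret S: sigma_finite_measure S by fact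
  note D = bounded_lipschitzD[OF K]
  have int: "integrable S (\<lambda>s. K s x)" for x
    by (rule Bochner_Integration.integrable_bound[OF B])
      (use D(1) in \<open>auto intro!: AE_I2 order_trans[OF _ abs_ge_self]\<close>)
  show lip: ?lip
  proof (rule bounded_lipschitzI)
    show "0 \<le> (\<integral>s. L s \<partial>S)" using D(4) by (intro Bochner_Integration.integral_nonneg)
    show "\<bar>\<integral>s. K s x \<partial>S\<bar> \<le> (\<integral>s. B s \<partial>S)" for x
      using int B D(1) by (intro order_trans[OF integral_abs_bound] integral_mono) auto
    fix x y
    have "\<bar>(\<integral>s. K s x \<partial>S) - (\<integral>s. K s y \<partial>S)\<bar> = \<bar>\<integral>s. K s x - K s y \<partial>S\<bar>"
      using int by simp
    also have "\<dots> \<le> (\<integral>s. L s * norm (x - y) \<partial>S)"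
      using int L D(2) by (intro order_trans[OF integral_abs_bound] integral_mono) auto
    finally show "\<bar>(\<integral>s. K s x \<partial>S) - (\<integral>s. K s y \<partial>S)\<bar> \<le> (\<integral>s. L s \<partial>S) * norm (x - y)"
      by simp
  qed
  assume st: "\<And>s. s \<in> space S \<Longrightarrow> stein_eq (K s)"
  interpret Mn: pair_sigma_finite M \<nu> ..
  interpret SM: pair_sigma_finite S M ..
  interpret SMn: pair_sigma_finite S "M \<Otimes>\<^sub>M \<nu>"
    ..
  \<comment> \<open>This is the constant from the increment bound for \<open>K s\<close>; it is
    integrable in \<open>s\<close>.\<close>
  define b where "b s = 2 * B s + L s" for s
  have b: "integrable S b" unfolding b_def using B L by simp
  have b0: "0 \<le> b s" if "s \<in> space S" for s using D(3,4)[OF that] by (simp add: b_def)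
  have [measurable]: "B \<in> borel_measurable S" "b \<in> borel_measurable S" using B b by auto
  \<comment> \<open>A function of the jump alone is integrable on the product since \<open>M\<close>
    has total mass 1.\<close>
  have wi: "integrable (M \<Otimes>\<^sub>M \<nu>) (\<lambda>p. weight (snd p))"
    by (rule Mn.Fubini_integrable) (use integrable_weight in auto)

  have I1: "integrable (S \<Otimes>\<^sub>M M) (\<lambda>(s, \<omega>). K s (X \<omega>) *\<^sub>R X \<omega>)"
  proof (rule Bochner_Integration.integrable_bound)
    show "integrable (S \<Otimes>\<^sub>M M) (\<lambda>(s, \<omega>). B s * norm (X \<omega>))"
      by (rule SM.Fubini_integrable) (use X_integrable B in \<open>auto simp: abs_mult\<close>)
    show "AE p in S \<Otimes>\<^sub>M M. norm (case p of (s, \<omega>) \<Rightarrow> K s (X \<omega>) *\<^sub>R X \<omega>)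
        \<le> norm (case p of (s, \<omega>) \<Rightarrow> B s * norm (X \<omega>))"
      using D(1,3) by (auto intro!: AE_I2 mult_right_mono simp: space_pair_measure)
  qed measurable
  have I2: "integrable (S \<Otimes>\<^sub>M M) (\<lambda>(s, \<omega>). K s (X \<omega>))"
  proof (rule Bochner_Integration.integrable_bound)
    show "integrable (S \<Otimes>\<^sub>M M) (\<lambda>(s, \<omega>). B s)"
      by (rule SM.Fubini_integrable) (use B in auto)
    show "AE p in S \<Otimes>\<^sub>M M. norm (case p of (s, \<omega>) \<Rightarrow> K s (X \<omega>)) \<le> norm (case p of (s, \<omega>) \<Rightarrow> B s)"
      using D(1,3) by (auto intro!: AE_I2 simp: space_pair_measure)
  qed measurable
  define G where "G s p = (K s (X (fst p) + snd p) - K s (X (fst p))) *\<^sub>R snd p" for s p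
  have Gm [measurable]: "case_prod G \<in> borel_measurable (S \<Otimes>\<^sub>M (M \<Otimes>\<^sub>M \<nu>))"
    unfolding G_def by measurable
  have G_le: "norm (G s p) \<le> b s * weight (snd p)" if "s \<in> space S" for s p
    unfolding G_def b_def by (rule increment_bound[OF K[OF that]])
  have I3: "integrable (S \<Otimes>\<^sub>M (M \<Otimes>\<^sub>M \<nu>)) (case_prod G)"
  proof (rule Bochner_Integration.integrable_bound)
    show "integrable (S \<Otimes>\<^sub>M (M \<Otimes>\<^sub>M \<nu>)) (\<lambda>(s, p). b s * weight (snd p))"
      by (rule SMn.Fubini_integrable) (use wi b in \<open>auto simp: abs_mult\<close>)
    show "AE q in S \<Otimes>\<^sub>M (M \<Otimes>\<^sub>M \<nu>). norm (case_prod G q) \<le> norm (case q of (s, p) \<Rightarrow> b s * weight (snd p))"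
      using G_le by (auto intro!: AE_I2 order_trans[OF _ abs_ge_self] simp: space_pair_measure)
  qed measurable
  have inner: "integrable (M \<Otimes>\<^sub>M \<nu>) (G s)" if "s \<in> space S" for s
  proof (rule Bochner_Integration.integrable_bound)
    show "integrable (M \<Otimes>\<^sub>M \<nu>) (\<lambda>p. b s * weight (snd p))" using wi by simp
    show "G s \<in> borel_measurable (M \<Otimes>\<^sub>M \<nu>)"
      using measurable_compose[OF measurable_Pair1' Gm] that by simp
    show "AE p in M \<Otimes>\<^sub>M \<nu>. norm (G s p) \<le> norm (b s * weight (snd p))"
      using G_le[OF that] by (auto intro!: AE_I2 order_trans[OF _ abs_ge_self])
  qed
  have GJ: "integral\<^sup>L (M \<Otimes>\<^sub>M \<nu>) (G s) = (\<integral>\<omega>. jump (K s) (X \<omega>) \<partial>M)" if "s \<in> space S" for s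
  proof -
    have "integral\<^sup>L (M \<Otimes>\<^sub>M \<nu>) (G s) = (\<integral>\<omega>. (\<integral>u. G s (\<omega>, u) \<partial>\<nu>) \<partial>M)"
      by (rule Mn.integral_fst'[OF inner[OF that], symmetric])
    then show ?thesis by (simp only: G_def jump_def fst_conv snd_conv)
  qed
  \<comment> \<open>\<open>M\<close> and \<open>\<nu>\<close> are integrated jointly so that one exchange with \<open>S\<close> suffices.\<close>
  have E3: "(\<integral>\<omega>. jump (\<lambda>x. \<integral>s. K s x \<partial>S) (X \<omega>) \<partial>M) = (\<integral>s. (\<integral>\<omega>. jump (K s) (X \<omega>) \<partial>M) \<partial>S)"
  proof -
    have "jump (\<lambda>x. \<integral>s. K s x \<partial>S) (X \<omega>) = (\<integral>u. (\<integral>s. G s (\<omega>, u) \<partial>S) \<partial>\<nu>)" for \<omega>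
      unfolding jump_def
    proof (intro Bochner_Integration.integral_cong refl)
      fix u
      have "(\<integral>s. G s (\<omega>, u) \<partial>S) = (\<integral>s. K s (X \<omega> + u) - K s (X \<omega>) \<partial>S) *\<^sub>R u"
        unfolding G_def fst_conv snd_conv using int by (intro integral_scaleR_left) auto
      then show "((\<integral>s. K s (X \<omega> + u) \<partial>S) - (\<integral>s. K s (X \<omega>) \<partial>S)) *\<^sub>R u = (\<integral>s. G s (\<omega>, u) \<partial>S)"
        using int by simp
    qed
    then have "(\<integral>\<omega>. jump (\<lambda>x. \<integral>s. K s x \<partial>S) (X \<omega>) \<partial>M)
        = (\<integral>\<omega>. (\<integral>u. (\<integral>s. G s (\<omega>, u) \<partial>S) \<partial>\<nu>) \<partial>M)" by simp
    also have "\<dots> = (\<integral>p. (\<integral>s. G s p \<partial>S) \<partial>(M \<Otimes>\<^sub>M \<nu>))"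
      using SMn.integrable_snd[OF I3] by (intro Mn.integral_fst')
    also have "\<dots> = (\<integral>s. (\<integral>p. G s p \<partial>(M \<Otimes>\<^sub>M \<nu>)) \<partial>S)"
      by (rule SMn.Fubini_integral[OF I3])
    also have "\<dots> = (\<integral>s. (\<integral>\<omega>. jump (K s) (X \<omega>) \<partial>M) \<partial>S)"
      by (intro Bochner_Integration.integral_cong refl GJ)
    finally show ?thesis .
  qed
  have J: "integrable S (\<lambda>s. \<integral>\<omega>. jump (K s) (X \<omega>) \<partial>M)"
    using SMn.integrable_fst[OF I3] GJ by (simp cong: Bochner_Integration.integrable_cong)
  \<comment> \<open>The integral over \<open>S\<close> is pulled outside, the identity is applied
    for each \<open>s\<close>, and the integrals are exchanged back.\<close>
  have "(\<integral>\<omega>. (\<integral>s. K s (X \<omega>) \<partial>S) *\<^sub>R X \<omega> \<partial>M) = (\<integral>\<omega>. (\<integral>s. K s (X \<omega>) *\<^sub>R X \<omega> \<partial>S) \<partial>M)"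
    using int by simp
  also have "\<dots> = (\<integral>s. (\<integral>\<omega>. K s (X \<omega>) *\<^sub>R X \<omega> \<partial>M) \<partial>S)"
    by (rule SM.Fubini_integral[OF I1])
  also have "\<dots> = (\<integral>s. (\<integral>\<omega>. K s (X \<omega>) \<partial>M) *\<^sub>R (\<integral>\<omega>. X \<omega> \<partial>M) + (\<integral>\<omega>. jump (K s) (X \<omega>) \<partial>M) \<partial>S)"
    using st by (intro Bochner_Integration.integral_cong) (auto simp: stein_eq_def)
  also have "\<dots> = (\<integral>s. (\<integral>\<omega>. K s (X \<omega>) \<partial>M) \<partial>S) *\<^sub>R (\<integral>\<omega>. X \<omega> \<partial>M)
      + (\<integral>s. (\<integral>\<omega>. jump (K s) (X \<omega>) \<partial>M) \<partial>S)"
    using SM.integrable_fst[OF I2] J by simp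
  also have "(\<integral>s. (\<integral>\<omega>. K s (X \<omega>) \<partial>M) \<partial>S) = (\<integral>\<omega>. (\<integral>s. K s (X \<omega>) \<partial>S) \<partial>M)"
    by (rule SM.Fubini_integral[OF I2, symmetric])
  finally show "stein_eq (\<lambda>x. \<integral>s. K s x \<partial>S)" unfolding stein_eq_def E3 .
qed

end

section \<open>Trigonometric test functions\<close>

text \<open>Factoring out a number of modulus 1 reduces the claim to the first-order Taylor bound at
  0.\<close>

lemma norm_iexp_diff_le: "norm (iexp s - iexp t) \<le> \<bar>s - t\<bar>" for s t :: real
proof -
  have "iexp s - iexp t = iexp t * (iexp (s - t) - 1)"
    by (simp add: right_diff_distrib flip: exp_add)
  then show ?thesis
    using iexp_approx1[of "s - t" 0] by (simp add: norm_mult)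
qed

lemma abs_cos_diff_le: "\<bar>cos s - cos t\<bar> \<le> \<bar>s - t\<bar>" for s t :: real
  using order_trans[OF abs_Re_le_cmod norm_iexp_diff_le[of s t]] by (simp add: Re_exp)

lemma abs_sin_diff_le: "\<bar>sin s - sin t\<bar> \<le> \<bar>s - t\<bar>" for s t :: real
  using order_trans[OF abs_Im_le_cmod norm_iexp_diff_le[of s t]] by (simp add: Im_exp)

lemma bounded_lipschitz_cos: "bounded_lipschitz 1 (norm \<xi>) (\<lambda>x. cos (\<xi> \<bullet> x))"
  by (rule bounded_lipschitzI)
    (auto intro!: order_trans[OF abs_cos_diff_le] order_trans[OF Cauchy_Schwarz_ineq2]
      simp flip: inner_diff_right)

lemma bounded_lipschitz_sin: "bounded_lipschitz 1 (norm \<xi>) (\<lambda>x. sin (\<xi> \<bullet> x))"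
  by (rule bounded_lipschitzI)
    (auto intro!: order_trans[OF abs_sin_diff_le] order_trans[OF Cauchy_Schwarz_ineq2]
      simp flip: inner_diff_right)

section \<open>Gaussian vectors and the Gaussian bump\<close>

text \<open>The coordinates of \<open>gauss\<close> are indexed by \<^const>\<open>Basis\<close>; \<open>gauss_vec\<close> is then a standard Gaussian
  vector, and \<open>bell\<close> is its characteristic function, not its normalised density.\<close>

definition gauss :: "('b::euclidean_space \<Rightarrow> real) measure" where
  "gauss = Pi\<^sub>M Basis (\<lambda>_. std_normal_distribution)"

definition gauss_vec :: "('b::euclidean_space \<Rightarrow> real) \<Rightarrow> 'b" where
  "gauss_vec w = (\<Sum>b\<in>Basis. w b *\<^sub>R b)"

definition bell :: "'b::euclidean_space \<Rightarrow> real" where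
  "bell z = exp (- (norm z)\<^sup>2 / 2)"

lemma prob_space_gauss: "prob_space gauss"
  unfolding gauss_def by (intro prob_space_PiM prob_space_normal_density) simp

lemma sets_gauss [measurable_cong]: "sets gauss = sets (Pi\<^sub>M Basis (\<lambda>_. borel))"
  unfolding gauss_def by (intro sets_PiM_cong) auto

lemma gauss_vec_measurable [measurable]: "gauss_vec \<in> borel_measurable gauss"
  unfolding gauss_vec_def by measurable

lemma bell_prod: "bell z = (\<Prod>b\<in>Basis. exp (- (z \<bullet> b)\<^sup>2 / 2))"
proof -
  have "(norm z)\<^sup>2 = (\<Sum>b\<in>Basis. (z \<bullet> b)\<^sup>2)"
    unfolding power2_norm_eq_inner by (subst euclidean_inner) (simp add: power2_eq_square)
  then show ?thesis
    by (simp add: bell_def sum_negf sum_divide_distrib flip: exp_sum)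
qed

lemma bell_pos [simp]: "0 < bell z"
  by (simp add: bell_def)

lemma bell_measurable [measurable]: "bell \<in> borel_measurable borel"
  unfolding bell_def by measurable

text \<open>Independence of the coordinates factorises the complex characteristic function into
  one-dimensional ones; its real part is the claim. The bump is thereby a mixture of
  cosines.\<close>

lemma integral_gauss_cos: "(\<integral>w. cos (gauss_vec w \<bullet> a) \<partial>gauss) = bell (a :: 'b::euclidean_space)"
proof -
  interpret G: prob_space "gauss :: ('b \<Rightarrow> real) measure" by (rule prob_space_gauss)
  interpret N: prob_space std_normal_distribution by (rule prob_space_normal_density) simp
  interpret P: product_sigma_finite "\<lambda>_::'b. std_normal_distribution" ..
  have [measurable]: "(\<lambda>w. iexp (gauss_vec w \<bullet> a)) \<in> borel_measurable gauss" by measurable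
  have int: "integrable gauss (\<lambda>w. iexp (gauss_vec w \<bullet> a))"
    by (rule G.integrable_const_bound[where B = 1]) auto
  have "(\<integral>w. iexp (gauss_vec w \<bullet> a) \<partial>gauss)
      = (\<integral>w. (\<Prod>b\<in>Basis. iexp ((a \<bullet> b) * w b)) \<partial>Pi\<^sub>M Basis (\<lambda>_::'b. std_normal_distribution))"
    unfolding gauss_def gauss_vec_def
    by (simp add: inner_sum_left exp_sum sum_distrib_left inner_commute[of a] mult_ac)
  also have "\<dots> = (\<Prod>b\<in>Basis. char std_normal_distribution (a \<bullet> b))"
    unfolding char_def
    by (rule P.product_integral_prod) (auto intro!: N.integrable_const_bound[where B = 1])
  also have "\<dots> = complex_of_real (bell a)"
    unfolding char_std_normal_distribution bell_prod by simp
  finally have "Re (\<integral>w. iexp (gauss_vec w \<bullet> a) \<partial>gauss) = bell a" by simp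
  also have "Re (\<integral>w. iexp (gauss_vec w \<bullet> a) \<partial>gauss) = (\<integral>w. Re (iexp (gauss_vec w \<bullet> a)) \<partial>gauss)"
    using int by simp
  finally show ?thesis by (simp add: Re_exp)
qed

text \<open>The cosine with frequency \<open>gauss_vec w\<close> has Lipschitz constant at most
  \<open>norm (gauss_vec w)\<close>, and a mixture requires this to be integrable in
  \<open>w\<close>.\<close>

lemma integrable_norm_gauss_vec: "integrable gauss (\<lambda>w. norm (gauss_vec w :: 'b::euclidean_space))"
proof -
  have N: "prob_space std_normal_distribution" by (rule prob_space_normal_density) simp
  have "integrable gauss (\<lambda>w. \<bar>w b\<bar>)" if "b \<in> Basis" for b :: 'b
  proof -
    have "integrable std_normal_distribution (\<lambda>x::real. \<bar>x\<bar>)"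
      using integrable_std_normal_moment_abs[of 1] by (subst integrable_density) auto
    then have "integrable (distr gauss std_normal_distribution (\<lambda>w. w b)) (\<lambda>x::real. \<bar>x\<bar>)"
      unfolding gauss_def using distr_PiM_component[OF N that] by simp
    then show ?thesis
      using that by (subst (asm) integrable_distr_eq) (auto simp: gauss_def)
  qed
  then have "integrable gauss (\<lambda>w. \<Sum>b\<in>Basis. \<bar>w (b::'b)\<bar>)" by simp
  then show ?thesis
  proof (rule Bochner_Integration.integrable_bound)
    show "AE w in gauss. norm (norm (gauss_vec w)) \<le> norm (\<Sum>b\<in>Basis. \<bar>w (b::'b)\<bar>)"
      unfolding gauss_vec_def
      by (auto intro!: AE_I2 order_trans[OF norm_sum] order_trans[OF _ abs_ge_self])
  qed measurable
qed

lemma integrable_bell: "integrable lborel (bell :: 'b::euclidean_space \<Rightarrow> real)"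
proof (rule integrableI_bounded)
  have "(\<integral>\<^sup>+ z. ennreal (norm (bell (z :: 'b))) \<partial>lborel)
      = (\<integral>\<^sup>+ z. (\<Prod>b\<in>Basis. ennreal (exp (- (z \<bullet> b)\<^sup>2 / 2))) \<partial>(lborel :: 'b measure))"
    unfolding bell_prod by (simp add: prod_ennreal abs_of_nonneg prod_nonneg)
  also have "\<dots> = (\<Prod>b\<in>(Basis :: 'b set). \<integral>\<^sup>+ x. ennreal (exp (- x\<^sup>2 / 2)) \<partial>lborel)"
    by (rule nn_integral_lborel_prod) auto
  also have "\<dots> < \<infinity>"
  proof -
    have "integrable lborel (\<lambda>x::real. sqrt (2 * pi) * std_normal_density x)"
      using integrable_std_normal_moment[of 0] by simp
    then have "integrable lborel (\<lambda>x::real. exp (- x\<^sup>2 / 2))"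
      by (simp add: std_normal_density_def)
    then have "(\<integral>\<^sup>+ x. ennreal (exp (- (x::real)\<^sup>2 / 2)) \<partial>lborel) < \<infinity>"
      by (simp add: integrable_iff_bounded)
    then show ?thesis by (simp add: power_less_top_ennreal)
  qed
  finally show "(\<integral>\<^sup>+ z. ennreal (norm (bell (z :: 'b))) \<partial>lborel) < \<infinity>" .
qed measurable

text \<open>A vanishing integral would force the strictly positive bump to vanish almost everywhere.
  Positivity permits division by this integral when the kernel is normalised.\<close>

lemma integral_bell_pos: "0 < (\<integral>z. bell (z :: 'b::euclidean_space) \<partial>lborel)"
proof -
  have "(\<integral>z. bell (z :: 'b) \<partial>lborel) \<noteq> 0"
  proof
    assume "(\<integral>z. bell (z :: 'b) \<partial>lborel) = 0"
    then have "AE z in lborel. bell (z :: 'b) = 0"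
      using integrable_bell by (subst (asm) integral_nonneg_eq_0_iff_AE) (auto simp: less_imp_le)
    then have "AE z in lborel :: 'b measure. False"
      by eventually_elim (use bell_pos in \<open>auto simp: less_le\<close>)
    then show False by (simp add: AE_iff_null null_sets_def emeasure_lborel_UNIV)
  qed
  moreover have "0 \<le> (\<integral>z. bell (z :: 'b) \<partial>lborel)" by (simp add: less_imp_le)
  ultimately show ?thesis by simp
qed

text \<open>The substitution \<open>y = t + c *\<^sub>R z\<close> links two forms of a convolution:
  a mixture of translated bumps and an average of translates of a function.\<close>

lemma lborel_integral_affine_euclidean:
  fixes g :: "'b::euclidean_space \<Rightarrow> real"
  assumes [measurable]: "g \<in> borel_measurable borel" and "c \<noteq> 0"
  shows "(\<integral>y. g y \<partial>lborel) = \<bar>c\<bar> ^ DIM('b) * (\<integral>z. g (t + c *\<^sub>R z) \<partial>lborel)"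
  by (subst lborel_affine[OF \<open>c \<noteq> 0\<close>, of t])
    (simp add: integral_density integral_distr)

section \<open>From characters to all bounded Lipschitz functions\<close>

context stein begin

text \<open>\<open>L\<close> is chosen before \<open>y\<close>: one Lipschitz constant for all
  translates is what a further mixture over \<open>y\<close> requires. The witness is the mean of
  the Lipschitz constants of the cosines being mixed.\<close>

lemma stein_eq_bell:
  assumes c: "\<And>\<xi>. stein_eq (\<lambda>x. cos (\<xi> \<bullet> x))" and s: "\<And>\<xi>. stein_eq (\<lambda>x. sin (\<xi> \<bullet> x))"
  shows "\<exists>L. \<forall>y. bounded_lipschitz 1 L (\<lambda>x. bell (a *\<^sub>R (x - y))) \<and>
    stein_eq (\<lambda>x. bell (a *\<^sub>R (x - y)))"
proof (intro exI[of _ "\<integral>w. norm (a *\<^sub>R gauss_vec w :: real ^ 'd) \<partial>gauss"] allI conjI)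
  interpret G: prob_space "gauss :: (real ^ 'd \<Rightarrow> real) measure" by (rule prob_space_gauss)
  fix y :: "real ^ 'd"
  define K where "K w x = cos (gauss_vec w \<bullet> (a *\<^sub>R (x - y)))" for w and x :: "real ^ 'd"
  \<comment> \<open>The addition formula absorbs the translation by \<open>y\<close> into
    coefficients that do not depend on \<open>x\<close>.\<close>
  have K_eq: "K w = (\<lambda>x. cos ((a *\<^sub>R gauss_vec w) \<bullet> y) * cos ((a *\<^sub>R gauss_vec w) \<bullet> x)
      + sin ((a *\<^sub>R gauss_vec w) \<bullet> y) * sin ((a *\<^sub>R gauss_vec w) \<bullet> x))" for w
    by (simp add: K_def fun_eq_iff inner_diff_right right_diff_distrib cos_diff mult_ac)
  have st: "stein_eq (K w)" for w
    unfolding K_eq by (rule stein_eq_add[OF c s bounded_lipschitz_cos bounded_lipschitz_sin])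
  have lip: "bounded_lipschitz 1 (norm (a *\<^sub>R gauss_vec w)) (K w)" for w
  proof (rule bounded_lipschitzI)
    fix x x'
    have "\<bar>K w x - K w x'\<bar> \<le> \<bar>gauss_vec w \<bullet> (a *\<^sub>R (x - y)) - gauss_vec w \<bullet> (a *\<^sub>R (x' - y))\<bar>"
      unfolding K_def by (rule abs_cos_diff_le)
    also have "\<dots> = \<bar>(a *\<^sub>R gauss_vec w) \<bullet> (x - x')\<bar>"
      by (simp add: inner_diff_right algebra_simps)
    also have "\<dots> \<le> norm (a *\<^sub>R gauss_vec w) * norm (x - x')" by (rule Cauchy_Schwarz_ineq2)
    finally show "\<bar>K w x - K w x'\<bar> \<le> norm (a *\<^sub>R gauss_vec w) * norm (x - x')" .
  qed (auto simp: K_def)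
  have Km: "(\<lambda>(w, x). K w x) \<in> borel_measurable (gauss \<Otimes>\<^sub>M borel)"
    unfolding K_def by measurable
  have iL: "integrable gauss (\<lambda>w. norm (a *\<^sub>R gauss_vec w :: real ^ 'd))"
    unfolding norm_scaleR by (intro integrable_mult_right integrable_norm_gauss_vec)
  have sf: "sigma_finite_measure (gauss :: (real ^ 'd \<Rightarrow> real) measure)" ..
  have i1: "integrable gauss (\<lambda>w::real ^ 'd \<Rightarrow> real. 1::real)" by simp
  have eq: "(\<integral>w. K w x \<partial>gauss) = bell (a *\<^sub>R (x - y))" for x
    unfolding K_def by (rule integral_gauss_cos)
  show "bounded_lipschitz 1 (\<integral>w. norm (a *\<^sub>R gauss_vec w :: real ^ 'd) \<partial>gauss) (\<lambda>x. bell (a *\<^sub>R (x - y)))"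
    using bounded_lipschitz_mixture[OF sf Km i1 iL lip] unfolding eq by (simp add: G.prob_space)
  show "stein_eq (\<lambda>x. bell (a *\<^sub>R (x - y)))"
    using stein_eq_mixture[OF sf Km i1 iL lip st] unfolding eq .
qed

text \<open>The smoothed function is seen in two ways. As an average of translates of
  \<open>f\<close> it keeps the bounds \<open>B\<close> and \<open>L\<close> whatever the width; as
  a mixture of bumps with weights proportional to \<open>f y\<close> it satisfies the
  identity.\<close>

lemma stein_eq_compact_support:
  assumes c: "\<And>\<xi>. stein_eq (\<lambda>x. cos (\<xi> \<bullet> x))" and s: "\<And>\<xi>. stein_eq (\<lambda>x. sin (\<xi> \<bullet> x))"
    and f: "bounded_lipschitz B L f" and supp: "\<And>x. R < norm x \<Longrightarrow> f x = 0"
  shows "stein_eq f"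
proof -
  note D = bounded_lipschitzD[OF f]
  have [measurable]: "f \<in> borel_measurable borel" by (rule bounded_lipschitz_measurable[OF f])
  \<comment> \<open>The bounded support makes \<open>f\<close> an integrable weight for the mixture
    of bumps over Lebesgue measure.\<close>
  have f_int: "integrable lborel f"
  proof (rule Bochner_Integration.integrable_bound)
    show "integrable lborel (\<lambda>x::real ^ 'd. B * indicator (cball 0 R) x)"
      by (intro integrable_mult_right integrable_real_indicator emeasure_lborel_cball_finite) simp
    show "AE x in lborel. norm (f x) \<le> norm (B * indicator (cball 0 R) x)"
      using D(1,3) supp by (auto simp: indicator_def)
  qed measurable
  define \<kappa> where "\<kappa> = (\<integral>z. bell (z :: real ^ 'd) \<partial>lborel)"
  have \<kappa>: "0 < \<kappa>" unfolding \<kappa>_def by (rule integral_bell_pos)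
  \<comment> \<open>This is the convolution with the normalised Gaussian kernel of width \<epsilon>;
    the plus sign is harmless because the kernel is even.\<close>
  define g where "g \<epsilon> x = (\<integral>z. f (x + \<epsilon> *\<^sub>R z) * (bell z / \<kappa>) \<partial>lborel)" for \<epsilon> x
  have ib: "integrable lborel (\<lambda>z::real ^ 'd. C * (bell z / \<kappa>))" for C
    by (intro integrable_mult_right integrable_divide integrable_bell)
  have int1: "(\<integral>z. C * (bell (z :: real ^ 'd) / \<kappa>) \<partial>lborel) = C" for C
    using \<kappa> by (simp flip: \<kappa>_def)
  have g_lip: "bounded_lipschitz B L (g \<epsilon>)" for \<epsilon>
  proof -
    have lip: "bounded_lipschitz (B * (bell z / \<kappa>)) (L * (bell z / \<kappa>)) (\<lambda>x. f (x + \<epsilon> *\<^sub>R z) * (bell z / \<kappa>))" for z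
    proof (rule bounded_lipschitzI)
      show "\<bar>f (x + \<epsilon> *\<^sub>R z) * (bell z / \<kappa>)\<bar> \<le> B * (bell z / \<kappa>)" for x
        using \<kappa> D(1) by (auto simp: abs_mult less_imp_le intro!: divide_right_mono mult_right_mono)
      show "0 \<le> L * (bell z / \<kappa>)" using \<kappa> D(4) by (simp add: less_imp_le)
      fix x y
      have "\<bar>f (x + \<epsilon> *\<^sub>R z) * (bell z / \<kappa>) - f (y + \<epsilon> *\<^sub>R z) * (bell z / \<kappa>)\<bar>
          = \<bar>f (x + \<epsilon> *\<^sub>R z) - f (y + \<epsilon> *\<^sub>R z)\<bar> * (bell z / \<kappa>)"
        using \<kappa> by (simp add: abs_mult less_imp_le flip: left_diff_distrib diff_divide_distrib)
      also have "\<dots> \<le> (L * norm (x - y)) * (bell z / \<kappa>)"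
        using \<kappa> D(2)[of "x + \<epsilon> *\<^sub>R z" "y + \<epsilon> *\<^sub>R z"] by (intro mult_right_mono) (auto simp: less_imp_le)
      finally show "\<bar>f (x + \<epsilon> *\<^sub>R z) * (bell z / \<kappa>) - f (y + \<epsilon> *\<^sub>R z) * (bell z / \<kappa>)\<bar>
          \<le> L * (bell z / \<kappa>) * norm (x - y)" by (simp add: mult_ac)
    qed
    have m: "(\<lambda>(z, x). f (x + \<epsilon> *\<^sub>R z) * (bell z / \<kappa>)) \<in> borel_measurable (lborel \<Otimes>\<^sub>M borel)"
      by measurable
    show ?thesis
      using bounded_lipschitz_mixture[OF lborel.sigma_finite_measure_axioms m ib ib lip]
      unfolding int1 g_def .
  qed
  have g_stein: "stein_eq (g \<epsilon>)" if "0 < \<epsilon>" for \<epsilon>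
  proof -
    obtain L' where L': "\<And>y::real ^ 'd. bounded_lipschitz 1 L' (\<lambda>x. bell ((1 / \<epsilon>) *\<^sub>R (x - y)))"
      and st: "\<And>y. stein_eq (\<lambda>x. bell ((1 / \<epsilon>) *\<^sub>R (x - y)))"
      using stein_eq_bell[OF c s, of "1 / \<epsilon>"] by blast
    \<comment> \<open>The factor cancels the Jacobian of
      \<open>y = x + \<epsilon> *\<^sub>R z\<close> and carries the normalisation by
      \<kappa>.\<close>
    define C where "C = 1 / (\<kappa> * \<epsilon> ^ DIM(real ^ 'd))"
    \<comment> \<open>The summand with coefficient 0 lets closure under linear combinations act as
      closure under scaling.\<close>
    define K where "K y x = (C * f y) * bell ((1 / \<epsilon>) *\<^sub>R (x - y)) + 0 * bell ((1 / \<epsilon>) *\<^sub>R (x - y))" for y x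
    have K: "bounded_lipschitz (\<bar>C * f y\<bar> * 1 + \<bar>0\<bar> * 1) (\<bar>C * f y\<bar> * L' + \<bar>0\<bar> * L') (K y)" for y
      unfolding K_def by (rule bounded_lipschitz_add[OF L' L'])
    have stK: "stein_eq (K y)" for y
      unfolding K_def by (rule stein_eq_add[OF st st L' L'])
    have m: "(\<lambda>(y, x). K y x) \<in> borel_measurable (lborel \<Otimes>\<^sub>M borel)"
      unfolding K_def by measurable
    have "stein_eq (\<lambda>x. \<integral>y. K y x \<partial>lborel)"
      by (rule stein_eq_mixture[OF lborel.sigma_finite_measure_axioms m _ _ K stK])
        (use f_int in \<open>auto simp: abs_mult\<close>)
    also have "(\<lambda>x. \<integral>y. K y x \<partial>lborel) = g \<epsilon>"
    proof
      fix x
      have "(\<integral>y. K y x \<partial>lborel) = \<bar>\<epsilon>\<bar> ^ DIM(real ^ 'd) * (\<integral>z. K (x + \<epsilon> *\<^sub>R z) x \<partial>lborel)"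
        by (rule lborel_integral_affine_euclidean) (use that in \<open>auto simp: K_def\<close>)
      also have "\<dots> = (\<integral>z. \<epsilon> ^ DIM(real ^ 'd) * K (x + \<epsilon> *\<^sub>R z) x \<partial>lborel)" using that by simp
      also have "\<dots> = g \<epsilon> x"
        unfolding g_def using that \<kappa>
        by (intro Bochner_Integration.integral_cong) (auto simp: K_def C_def bell_def field_simps)
      finally show "(\<integral>y. K y x \<partial>lborel) = g \<epsilon> x" .
    qed
    finally show ?thesis .
  qed
  have lim: "(\<lambda>n. g (1 / real (Suc n)) x) \<longlonglongrightarrow> f x" for x
  proof -
    have cont: "isCont f x"
      using f by (auto simp: bounded_lipschitz_def dest!: lipschitz_on_continuous_on
          simp: continuous_on_eq_continuous_at)
    have pt: "(\<lambda>n. f (x + (1 / real (Suc n)) *\<^sub>R z)) \<longlonglongrightarrow> f x" for z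
    proof (rule isCont_tendsto_compose[OF cont])
      have "(\<lambda>n. x + (1 / real (Suc n)) *\<^sub>R z) \<longlonglongrightarrow> x + 0 *\<^sub>R z"
        by (intro tendsto_intros LIMSEQ_Suc[OF lim_1_over_n])
      then show "(\<lambda>n. x + (1 / real (Suc n)) *\<^sub>R z) \<longlonglongrightarrow> x" by simp
    qed
    have "(\<lambda>n. g (1 / real (Suc n)) x) \<longlonglongrightarrow> (\<integral>z. f x * (bell (z :: real ^ 'd) / \<kappa>) \<partial>lborel)"
      unfolding g_def
    proof (rule integral_dominated_convergence)
      show "integrable lborel (\<lambda>z::real ^ 'd. B * (bell z / \<kappa>))" by (rule ib)
      show "AE z in lborel. (\<lambda>n. f (x + (1 / real (Suc n)) *\<^sub>R z) * (bell z / \<kappa>)) \<longlonglongrightarrow> f x * (bell z / \<kappa>)"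
        using \<kappa> by (intro AE_I2 tendsto_intros pt)
      show "AE z in lborel. norm (f (x + (1 / real (Suc n)) *\<^sub>R z) * (bell z / \<kappa>)) \<le> B * (bell z / \<kappa>)" for n
        using \<kappa> D(1) by (auto simp: abs_mult less_imp_le intro!: divide_right_mono mult_right_mono)
    qed measurable
    then show ?thesis unfolding int1 .
  qed
  show ?thesis by (rule stein_eq_lim[OF g_lip g_stein lim]) simp
qed

text \<open>The cut-offs take values in [0, 1] and have Lipschitz constant 1, so all truncations of
  \<open>f\<close> share the bounds \<open>B\<close> and \<open>L + B\<close>.\<close>

lemma stein_eq_bounded_lipschitz:
  assumes c: "\<And>\<xi>. stein_eq (\<lambda>x. cos (\<xi> \<bullet> x))" and s: "\<And>\<xi>. stein_eq (\<lambda>x. sin (\<xi> \<bullet> x))"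
    and f: "bounded_lipschitz B L f"
  shows "stein_eq f"
proof -
  note D = bounded_lipschitzD[OF f]
  \<comment> \<open>For positive \<open>n\<close> this is 1 on the ball of radius
    \<open>n - 1\<close>, 0 outside the ball of radius \<open>n\<close>, and linear in the norm in
    between.\<close>
  define cut where "cut n x = max 0 (min 1 (real n - norm x))" for n and x :: "real ^ 'd"
  have cut: "0 \<le> cut n x" "cut n x \<le> 1" "\<bar>cut n x - cut n y\<bar> \<le> norm (x - y)" for n x y
    using norm_triangle_ineq3[of x y] by (auto simp: cut_def)
  have lip: "bounded_lipschitz B (L + B) (\<lambda>x. f x * cut n x)" for n
  proof (rule bounded_lipschitzI)
    show "\<bar>f x * cut n x\<bar> \<le> B" for x
      using mult_mono[OF D(1)[of x] cut(2)[of n x]] D(3) cut(1)[of n x] by (simp add: abs_mult)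
    show "0 \<le> L + B" using D by simp
    fix x y
    have "f x * cut n x - f y * cut n y = (f x - f y) * cut n x + f y * (cut n x - cut n y)"
      by (simp add: algebra_simps)
    also have "\<bar>\<dots>\<bar> \<le> \<bar>f x - f y\<bar> * cut n x + \<bar>f y\<bar> * \<bar>cut n x - cut n y\<bar>"
      using cut(1) by (intro order_trans[OF abs_triangle_ineq]) (simp add: abs_mult)
    also have "\<dots> \<le> (L * norm (x - y)) * 1 + B * norm (x - y)"
      using cut D by (intro add_mono mult_mono) auto
    finally show "\<bar>f x * cut n x - f y * cut n y\<bar> \<le> (L + B) * norm (x - y)" by (simp add: algebra_simps)
  qed
  have st: "stein_eq (\<lambda>x. f x * cut n x)" for n
    by (rule stein_eq_compact_support[OF c s lip[of n], of "real n"]) (simp add: cut_def)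
  have lim: "(\<lambda>n. f x * cut n x) \<longlonglongrightarrow> f x" for x
  proof (rule tendsto_eventually)
    obtain N where N: "1 + norm x < real N" using reals_Archimedean2 by blast
    have "f x * cut n x = f x" if "N \<le> n" for n
    proof -
      have "real N \<le> real n" using that by simp
      then show ?thesis using N by (simp add: cut_def)
    qed
    then show "\<forall>\<^sub>F n in sequentially. f x * cut n x = f x" by (auto simp: eventually_sequentially)
  qed
  show ?thesis by (rule stein_eq_lim[OF lip st lim])
qed

end

section \<open>Differentiation under the integral sign\<close>

lemma has_vector_derivative_at_0_iff:
  "(f has_vector_derivative D) (at 0) \<longleftrightarrow> ((\<lambda>h. (f h - f 0) /\<^sub>R h) \<longlongrightarrow> D) (at 0)"
proof -
  have "norm (f h - f 0 - h *\<^sub>R D) / norm h = norm ((f h - f 0) /\<^sub>R h - D)" if "h \<noteq> 0" for h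
  proof -
    have "(f h - f 0) /\<^sub>R h - D = (f h - f 0 - h *\<^sub>R D) /\<^sub>R h"
      using that by (simp add: scaleR_diff_right)
    then show ?thesis by (simp add: divide_inverse mult.commute)
  qed
  then have "((\<lambda>h. norm (f h - f 0 - h *\<^sub>R D) / norm h) \<longlongrightarrow> 0) (at 0)
      \<longleftrightarrow> ((\<lambda>h. norm ((f h - f 0) /\<^sub>R h - D)) \<longlongrightarrow> 0) (at 0)"
    by (intro filterlim_cong refl) (auto simp: eventually_at_filter)
  then show ?thesis
    by (simp add: has_vector_derivative_def has_derivative_at bounded_linear_scaleR_left
        tendsto_norm_zero_iff LIM_zero_iff)
qed

text \<open>Difference quotients along a sequence tending to 0 are dominated by \<open>g\<close>, so
  dominated convergence gives the limit. The point 0 is enough because lines are parametrised from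
  the point of interest.\<close>

lemma has_vector_derivative_integral_at_0:
  fixes F :: "real \<Rightarrow> 'b \<Rightarrow> 'c::{banach, second_countable_topology}"
  assumes int: "\<And>h. integrable N (F h)" and [measurable]: "F' \<in> borel_measurable N"
    and deriv: "\<And>x. ((\<lambda>h. F h x) has_vector_derivative F' x) (at 0)"
    and bound: "\<And>h x. \<bar>h\<bar> \<le> 1 \<Longrightarrow> norm (F h x - F 0 x) \<le> \<bar>h\<bar> * g x"
    and g: "integrable N g"
  shows "((\<lambda>h. \<integral>x. F h x \<partial>N) has_vector_derivative (\<integral>x. F' x \<partial>N)) (at 0)"
  unfolding has_vector_derivative_at_0_iff tendsto_at_iff_sequentially comp_def
proof (intro allI impI)
  fix S :: "nat \<Rightarrow> real"
  assume S: "\<forall>i. S i \<in> UNIV - {0}" and S0: "S \<longlonglongrightarrow> 0"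
  have [measurable]: "F h \<in> borel_measurable N" for h using int by auto
  obtain k where k: "\<And>n. n \<ge> k \<Longrightarrow> \<bar>S n\<bar> \<le> 1"
    using LIMSEQ_D[OF S0, of 1] by (auto intro: less_imp_le)
  have eq: "((\<integral>x. F h x \<partial>N) - (\<integral>x. F 0 x \<partial>N)) /\<^sub>R h = (\<integral>x. (F h x - F 0 x) /\<^sub>R h \<partial>N)" for h
    using int by simp
  show "(\<lambda>n. ((\<integral>x. F (S n) x \<partial>N) - (\<integral>x. F 0 x \<partial>N)) /\<^sub>R S n) \<longlonglongrightarrow> (\<integral>x. F' x \<partial>N)"
    unfolding eq
  \<comment> \<open>The bound is available for increments of size at most 1 only, so the first
    \<open>k\<close> terms are dropped.\<close>
  proof (rule LIMSEQ_offset[where k = k], rule integral_dominated_convergence[OF _ _ g])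
    have "(\<lambda>n. (F (S n) x - F 0 x) /\<^sub>R S n) \<longlonglongrightarrow> F' x" for x
      using deriv[of x] S S0 unfolding has_vector_derivative_at_0_iff tendsto_at_iff_sequentially comp_def
      by blast
    then show "AE x in N. (\<lambda>n. (F (S (n + k)) x - F 0 x) /\<^sub>R S (n + k)) \<longlonglongrightarrow> F' x"
      by (intro AE_I2 LIMSEQ_ignore_initial_segment)
    have "norm ((F (S (n + k)) x - F 0 x) /\<^sub>R S (n + k)) \<le> g x" for n x
      using bound[OF k[of "n + k"], of x] S
      by (simp add: inverse_eq_divide pos_divide_le_eq mult.commute)
    then show "AE x in N. norm ((F (S (n + k)) x - F 0 x) /\<^sub>R S (n + k)) \<le> g x" for n
      by simp
  qed measurable
qed

lemma has_vector_derivative_shift_at_0: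
  assumes "((\<lambda>h. f (t + h)) has_vector_derivative D) (at 0)"
  shows "(f has_vector_derivative D) (at t)"
proof -
  have "((\<lambda>s. s - t) has_vector_derivative 1) (at t)"
    by (auto intro!: derivative_eq_intros)
  from vector_diff_chain_at[OF this, of "\<lambda>h. f (t + h)" D] assms
  show ?thesis by (simp add: comp_def)
qed

lemma has_vector_derivative_iexp_line:
  "((\<lambda>h. iexp ((\<xi> + h *\<^sub>R \<eta>) \<bullet> x)) has_vector_derivative
    \<i> * of_real (\<eta> \<bullet> x) * iexp (\<xi> \<bullet> x)) (at 0)"
proof -
  have "((\<lambda>z. exp (\<i> * (of_real (\<xi> \<bullet> x) + z * of_real (\<eta> \<bullet> x)))) has_field_derivative
      \<i> * of_real (\<eta> \<bullet> x) * iexp (\<xi> \<bullet> x)) (at (of_real 0))"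
    by (auto intro!: derivative_eq_intros)
  from has_vector_derivative_real_field[OF this] show ?thesis
    by (simp add: inner_add_left)
qed

lemma norm_iexp_minus_1_le: "norm (iexp a - 1) \<le> \<bar>a\<bar>" for a :: real
  using norm_iexp_diff_le[of a 0] by simp

lemma norm_iexp_linear_le: "norm (iexp a - 1 - \<i> * of_real a) \<le> a\<^sup>2 / 2" for a :: real
  using iexp_approx1[of a 1] by (simp add: atMost_Suc power2_eq_square algebra_simps numeral_2_eq_2)

lemma iexp_eq_cos_sin: "iexp a = of_real (cos a) + \<i> * of_real (sin a)" for a :: real
  by (simp add: exp_Euler cos_of_real sin_of_real)

section \<open>Derivatives of the characteristic function and of the exponent\<close>

context stein begin

text \<open>With \<open>sin_drift\<close> this gives the real and imaginary parts of the integral of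
  \<open>(iexp (\<xi> \<bullet> u) - 1) u\<close> over \<nu>.\<close>

definition cos_drift :: "real ^ 'd \<Rightarrow> real ^ 'd" where
  "cos_drift \<xi> = (\<integral>u. (cos (\<xi> \<bullet> u) - 1) *\<^sub>R u \<partial>\<nu>)"

definition sin_drift :: "real ^ 'd \<Rightarrow> real ^ 'd" where
  "sin_drift \<xi> = (\<integral>u. sin (\<xi> \<bullet> u) *\<^sub>R u \<partial>\<nu>)"

abbreviation mean :: "real ^ 'd" where
  "mean \<equiv> \<integral>\<omega>. X \<omega> \<partial>M"

abbreviation drift :: "real ^ 'd" where
  "drift \<equiv> mean - (LINT u:{u. 1 < norm u}|\<nu>. u)"

abbreviation \<phi> :: "real ^ 'd \<Rightarrow> complex" where
  "\<phi> \<xi> \<equiv> vec_char (distr M borel X) \<xi>"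

abbreviation \<psi> :: "real ^ 'd \<Rightarrow> complex" where
  "\<psi> \<xi> \<equiv> levy_khintchine_exponent drift 0 \<nu> \<xi>"

lemma integrable_cos_drift: "integrable \<nu> (\<lambda>u. (cos (\<xi> \<bullet> u) - 1) *\<^sub>R u)"
  using integrable_increment[OF bounded_lipschitz_cos[of \<xi>], of 0] by simp

lemma integrable_sin_drift: "integrable \<nu> (\<lambda>u. sin (\<xi> \<bullet> u) *\<^sub>R u)"
  using integrable_increment[OF bounded_lipschitz_sin[of \<xi>], of 0] by simp

lemma jump_cos: "jump (\<lambda>x. cos (\<xi> \<bullet> x)) x = cos (\<xi> \<bullet> x) *\<^sub>R cos_drift \<xi> - sin (\<xi> \<bullet> x) *\<^sub>R sin_drift \<xi>"
proof -
  have "jump (\<lambda>x. cos (\<xi> \<bullet> x)) x = (\<integral>u. cos (\<xi> \<bullet> x) *\<^sub>R ((cos (\<xi> \<bullet> u) - 1) *\<^sub>R u)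
      - sin (\<xi> \<bullet> x) *\<^sub>R (sin (\<xi> \<bullet> u) *\<^sub>R u) \<partial>\<nu>)"
    unfolding jump_def
    by (intro Bochner_Integration.integral_cong) (auto simp: inner_add_right cos_add algebra_simps)
  also have "\<dots> = cos (\<xi> \<bullet> x) *\<^sub>R cos_drift \<xi> - sin (\<xi> \<bullet> x) *\<^sub>R sin_drift \<xi>"
    unfolding cos_drift_def sin_drift_def using integrable_cos_drift[of \<xi>] integrable_sin_drift[of \<xi>] by (simp del: scaleR_scaleR)
  finally show ?thesis .
qed

lemma jump_sin: "jump (\<lambda>x. sin (\<xi> \<bullet> x)) x = sin (\<xi> \<bullet> x) *\<^sub>R cos_drift \<xi> + cos (\<xi> \<bullet> x) *\<^sub>R sin_drift \<xi>"
proof -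
  have "jump (\<lambda>x. sin (\<xi> \<bullet> x)) x = (\<integral>u. sin (\<xi> \<bullet> x) *\<^sub>R ((cos (\<xi> \<bullet> u) - 1) *\<^sub>R u)
      + cos (\<xi> \<bullet> x) *\<^sub>R (sin (\<xi> \<bullet> u) *\<^sub>R u) \<partial>\<nu>)"
    unfolding jump_def
    by (intro Bochner_Integration.integral_cong) (auto simp: inner_add_right sin_add algebra_simps)
  also have "\<dots> = sin (\<xi> \<bullet> x) *\<^sub>R cos_drift \<xi> + cos (\<xi> \<bullet> x) *\<^sub>R sin_drift \<xi>"
    unfolding cos_drift_def sin_drift_def using integrable_cos_drift[of \<xi>] integrable_sin_drift[of \<xi>] by (simp del: scaleR_scaleR)
  finally show ?thesis .
qed

lemma phi_eq: "\<phi> \<xi> = of_real (\<integral>\<omega>. cos (\<xi> \<bullet> X \<omega>) \<partial>M) + \<i> * of_real (\<integral>\<omega>. sin (\<xi> \<bullet> X \<omega>) \<partial>M)"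
proof -
  have "\<phi> \<xi> = (\<integral>\<omega>. of_real (cos (\<xi> \<bullet> X \<omega>)) + \<i> * of_real (sin (\<xi> \<bullet> X \<omega>)) \<partial>M)"
    unfolding vec_char_def by (subst integral_distr) (auto simp: iexp_eq_cos_sin)
  then show ?thesis
    using integrable_comp[OF bounded_lipschitz_cos[of \<xi>]] integrable_comp[OF bounded_lipschitz_sin[of \<xi>]]
    by simp
qed

text \<open>This is the expectation of
  \<open>\<i> (\<eta> \<bullet> X) iexp (\<xi> \<bullet> X)\<close>, split into integrals of real
  vectors so that it can be compared with the identity for cosine and sine.\<close>

definition d\<phi> :: "real ^ 'd \<Rightarrow> real ^ 'd \<Rightarrow> complex" where
  "d\<phi> \<xi> \<eta> = \<i> * (of_real (\<eta> \<bullet> (\<integral>\<omega>. cos (\<xi> \<bullet> X \<omega>) *\<^sub>R X \<omega> \<partial>M))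
    + \<i> * of_real (\<eta> \<bullet> (\<integral>\<omega>. sin (\<xi> \<bullet> X \<omega>) *\<^sub>R X \<omega> \<partial>M)))"

definition d\<psi> :: "real ^ 'd \<Rightarrow> real ^ 'd \<Rightarrow> complex" where
  "d\<psi> \<xi> \<eta> = \<i> * (of_real (\<eta> \<bullet> (mean + cos_drift \<xi>)) + \<i> * of_real (\<eta> \<bullet> sin_drift \<xi>))"

lemma phi_derivative: "((\<lambda>h. \<phi> (\<xi> + h *\<^sub>R \<eta>)) has_vector_derivative d\<phi> \<xi> \<eta>) (at 0)"
proof -
  have \<phi>: "\<phi> \<zeta> = (\<integral>\<omega>. iexp (\<zeta> \<bullet> X \<omega>) \<partial>M)" for \<zeta>
    unfolding vec_char_def by (subst integral_distr) auto
  have "((\<lambda>h. \<integral>\<omega>. iexp ((\<xi> + h *\<^sub>R \<eta>) \<bullet> X \<omega>) \<partial>M) has_vector_derivative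
      (\<integral>\<omega>. \<i> * of_real (\<eta> \<bullet> X \<omega>) * iexp (\<xi> \<bullet> X \<omega>) \<partial>M)) (at 0)"
  proof (rule has_vector_derivative_integral_at_0[OF _ _ has_vector_derivative_iexp_line])
    show "integrable M (\<lambda>\<omega>. iexp ((\<xi> + h *\<^sub>R \<eta>) \<bullet> X \<omega>))" for h
      by (rule integrable_const_bound[where B = 1]) auto
    show "integrable M (\<lambda>\<omega>. \<bar>\<eta> \<bullet> X \<omega>\<bar>)" using X_integrable by simp
    show "norm (iexp ((\<xi> + h *\<^sub>R \<eta>) \<bullet> X \<omega>) - iexp ((\<xi> + 0 *\<^sub>R \<eta>) \<bullet> X \<omega>)) \<le> \<bar>h\<bar> * \<bar>\<eta> \<bullet> X \<omega>\<bar>" for h \<omega>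
      by (rule order_trans[OF norm_iexp_diff_le]) (simp add: inner_add_left abs_mult)
  qed measurable
  also have "(\<integral>\<omega>. \<i> * of_real (\<eta> \<bullet> X \<omega>) * iexp (\<xi> \<bullet> X \<omega>) \<partial>M)
      = (\<integral>\<omega>. \<i> * (of_real (\<eta> \<bullet> (cos (\<xi> \<bullet> X \<omega>) *\<^sub>R X \<omega>))
          + \<i> * of_real (\<eta> \<bullet> (sin (\<xi> \<bullet> X \<omega>) *\<^sub>R X \<omega>))) \<partial>M)"
    by (intro Bochner_Integration.integral_cong) (auto simp: iexp_eq_cos_sin algebra_simps)
  also have "\<dots> = d\<phi> \<xi> \<eta>"
    unfolding d\<phi>_def using integrable_comp_scale[OF bounded_lipschitz_cos[of \<xi>]]
      integrable_comp_scale[OF bounded_lipschitz_sin[of \<xi>]]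
    by (simp del: inner_scaleR_right)
  finally show ?thesis unfolding \<phi> .
qed

lemma inner_square_le: "(x \<bullet> y)\<^sup>2 \<le> (norm x)\<^sup>2 * (norm y)\<^sup>2" for x y :: "'b::real_inner"
  using power_mono[OF Cauchy_Schwarz_ineq2[of x y] abs_ge_zero, of 2] by (simp add: power_mult_distrib)

text \<open>No truncation survives in \<open>d\<psi>\<close>: differentiating the compensator leaves
  an integral of \<open>u\<close> over jumps of norm above 1, and the choice of \<open>drift\<close>
  cancels it.\<close>

lemma psi_derivative: "((\<lambda>h. \<psi> (\<xi> + h *\<^sub>R \<eta>)) has_vector_derivative d\<psi> \<xi> \<eta>) (at 0)"
proof -
  define F where "F \<zeta> u = iexp (\<zeta> \<bullet> u) - 1 - \<i> * of_real (\<zeta> \<bullet> u) * indicator {v. norm v \<le> 1} u" for \<zeta> u :: "real ^ 'd"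
  define F' where "F' u = \<i> * of_real (\<eta> \<bullet> u) * iexp (\<xi> \<bullet> u)
    - \<i> * of_real (\<eta> \<bullet> u) * indicator {v. norm v \<le> 1} u" for u :: "real ^ 'd"
  have [measurable]: "F \<zeta> \<in> borel_measurable borel" "F' \<in> borel_measurable borel" for \<zeta>
    unfolding F_def F'_def by measurable
  have weight_small: "weight u = (norm u)\<^sup>2" if "norm u \<le> 1" for u
    using that by (simp add: weight_def power2_eq_square)
  have weight_large: "weight u = norm u" if "\<not> norm u \<le> 1" for u
    using that by (simp add: weight_def)
  have F_int: "integrable \<nu> (F \<zeta>)" for \<zeta>
  \<comment> \<open>The squared norm serves the second-order remainder on the unit ball, the 2 the
    trivial bound outside.\<close>
  proof (rule integrable_weight_bound[where c = "(norm \<zeta>)\<^sup>2 + 2"])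
    fix u
    show "norm (F \<zeta> u) \<le> ((norm \<zeta>)\<^sup>2 + 2) * weight u"
    proof (cases "norm u \<le> 1")
      case True
      have "norm (F \<zeta> u) \<le> (\<zeta> \<bullet> u)\<^sup>2 / 2"
        using norm_iexp_linear_le[of "\<zeta> \<bullet> u"] True by (simp add: F_def)
      also have "\<dots> \<le> ((norm \<zeta>)\<^sup>2 + 2) * (norm u)\<^sup>2"
        using inner_square_le[of \<zeta> u] zero_le_power2[of "\<zeta> \<bullet> u"] zero_le_power2[of "norm u"]
        unfolding distrib_right by linarith
      finally show ?thesis using weight_small[OF True] by simp
    next
      case False
      have "norm (F \<zeta> u) \<le> 2"
        using norm_triangle_ineq4[of "iexp (\<zeta> \<bullet> u)" 1] False by (simp add: F_def)
      also have "\<dots> \<le> ((norm \<zeta>)\<^sup>2 + 2) * norm u"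
        using False mult_mono[of 2 "(norm \<zeta>)\<^sup>2 + 2" 1 "norm u"] by simp
      finally show ?thesis using weight_large[OF False] by simp
    qed
  qed measurable
  have D: "((\<lambda>h. \<integral>u. F (\<xi> + h *\<^sub>R \<eta>) u \<partial>\<nu>) has_vector_derivative (\<integral>u. F' u \<partial>\<nu>)) (at 0)"
  proof (rule has_vector_derivative_integral_at_0[where F = "\<lambda>h u. F (\<xi> + h *\<^sub>R \<eta>) u"])
    \<comment> \<open>The three summands come from the second-order remainder, from the cross term,
      and from the jumps of norm above 1.\<close>
    define c where "c = (norm \<eta>)\<^sup>2 + norm \<eta> * norm \<xi> + norm \<eta>"
    show "integrable \<nu> (\<lambda>u. c * weight u)" using integrable_weight by simp
    show "((\<lambda>h. F (\<xi> + h *\<^sub>R \<eta>) u) has_vector_derivative F' u) (at 0)" for u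
    proof -
      have "((\<lambda>h. (\<xi> + h *\<^sub>R \<eta>) \<bullet> u) has_real_derivative \<eta> \<bullet> u) (at 0)"
        unfolding inner_add_left inner_scaleR_left by (auto intro!: derivative_eq_intros)
      then show ?thesis
        unfolding F_def F'_def
        by (auto intro!: derivative_eq_intros has_vector_derivative_iexp_line)
    qed
    fix h :: real and u assume h: "\<bar>h\<bar> \<le> 1"
    show "norm (F (\<xi> + h *\<^sub>R \<eta>) u - F (\<xi> + 0 *\<^sub>R \<eta>) u) \<le> \<bar>h\<bar> * (c * weight u)"
    proof (cases "norm u \<le> 1")
      case True
      \<comment> \<open>A second-order remainder and a cross term remain, both quadratic in
        \<open>u\<close>. The remainder is also quadratic in \<open>h\<close>, and
        \<open>\<bar>h\<bar> \<le> 1\<close> turns that into a linear bound.\<close>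
      have "F (\<xi> + h *\<^sub>R \<eta>) u - F (\<xi> + 0 *\<^sub>R \<eta>) u
          = iexp (\<xi> \<bullet> u) * (iexp (h * (\<eta> \<bullet> u)) - 1 - \<i> * of_real (h * (\<eta> \<bullet> u)))
            + \<i> * of_real (h * (\<eta> \<bullet> u)) * (iexp (\<xi> \<bullet> u) - 1)"
        using True by (simp add: F_def inner_add_left exp_add algebra_simps)
      also have "norm \<dots> \<le> (h * (\<eta> \<bullet> u))\<^sup>2 / 2 + \<bar>h * (\<eta> \<bullet> u)\<bar> * \<bar>\<xi> \<bullet> u\<bar>"
      proof (rule norm_triangle_le, rule add_mono)
        show "norm (iexp (\<xi> \<bullet> u) * (iexp (h * (\<eta> \<bullet> u)) - 1 - \<i> * of_real (h * (\<eta> \<bullet> u)))) \<le> (h * (\<eta> \<bullet> u))\<^sup>2 / 2"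
          unfolding norm_mult norm_exp_i_times mult_1 by (rule norm_iexp_linear_le)
        have "norm (\<i> * of_real (h * (\<eta> \<bullet> u)) * (iexp (\<xi> \<bullet> u) - 1)) = \<bar>h * (\<eta> \<bullet> u)\<bar> * norm (iexp (\<xi> \<bullet> u) - 1)"
          by (simp only: norm_mult norm_ii norm_of_real mult_1 of_real_mult[symmetric])
        then show "norm (\<i> * of_real (h * (\<eta> \<bullet> u)) * (iexp (\<xi> \<bullet> u) - 1)) \<le> \<bar>h * (\<eta> \<bullet> u)\<bar> * \<bar>\<xi> \<bullet> u\<bar>"
          by (simp only:) (intro mult_left_mono norm_iexp_minus_1_le abs_ge_zero)
      qed
      also have "\<dots> \<le> \<bar>h\<bar> * ((norm \<eta>)\<^sup>2 * (norm u)\<^sup>2) + \<bar>h\<bar> * (norm \<eta> * norm \<xi> * (norm u)\<^sup>2)"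
      proof (rule add_mono)
        have "(h * (\<eta> \<bullet> u))\<^sup>2 / 2 \<le> h\<^sup>2 * (\<eta> \<bullet> u)\<^sup>2"
          using zero_le_power2[of "h * (\<eta> \<bullet> u)"] unfolding power_mult_distrib[symmetric] by linarith
        also have "\<dots> \<le> \<bar>h\<bar> * ((norm \<eta>)\<^sup>2 * (norm u)\<^sup>2)"
          using inner_square_le[of \<eta> u] mult_left_mono[OF h abs_ge_zero[of h]]
          by (intro mult_mono) (auto simp: power2_eq_square abs_mult_self_eq)
        finally show "(h * (\<eta> \<bullet> u))\<^sup>2 / 2 \<le> \<bar>h\<bar> * ((norm \<eta>)\<^sup>2 * (norm u)\<^sup>2)" .
        have "\<bar>\<eta> \<bullet> u\<bar> * \<bar>\<xi> \<bullet> u\<bar> \<le> (norm \<eta> * norm u) * (norm \<xi> * norm u)"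
          by (intro mult_mono Cauchy_Schwarz_ineq2) auto
        then have "\<bar>h\<bar> * (\<bar>\<eta> \<bullet> u\<bar> * \<bar>\<xi> \<bullet> u\<bar>) \<le> \<bar>h\<bar> * ((norm \<eta> * norm u) * (norm \<xi> * norm u))"
          by (intro mult_left_mono) auto
        then show "\<bar>h * (\<eta> \<bullet> u)\<bar> * \<bar>\<xi> \<bullet> u\<bar> \<le> \<bar>h\<bar> * (norm \<eta> * norm \<xi> * (norm u)\<^sup>2)"
          by (simp add: abs_mult power2_eq_square mult_ac)
      qed
      also have "\<dots> \<le> \<bar>h\<bar> * (c * (norm u)\<^sup>2)"
        unfolding c_def by (simp add: distrib_left distrib_right)
      finally show ?thesis using weight_small[OF True] by simp
    next
      case False
      have "norm (F (\<xi> + h *\<^sub>R \<eta>) u - F (\<xi> + 0 *\<^sub>R \<eta>) u) = norm (iexp ((\<xi> + h *\<^sub>R \<eta>) \<bullet> u) - iexp (\<xi> \<bullet> u))"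
        using False by (simp add: F_def)
      also have "\<dots> \<le> \<bar>h\<bar> * \<bar>\<eta> \<bullet> u\<bar>"
        by (rule order_trans[OF norm_iexp_diff_le]) (simp add: inner_add_left abs_mult)
      also have "\<dots> \<le> \<bar>h\<bar> * (norm \<eta> * norm u)"
        by (intro mult_left_mono Cauchy_Schwarz_ineq2) auto
      also have "\<dots> \<le> \<bar>h\<bar> * (c * norm u)"
        by (intro mult_left_mono mult_right_mono) (auto simp: c_def)
      finally show ?thesis using weight_large[OF False] by simp
    qed
  qed (use F_int in simp_all)
  have tail: "integrable \<nu> (\<lambda>u. indicator {u. 1 < norm u} u *\<^sub>R u)"
    by (rule integrable_weight_bound[where c = 1]) (auto simp: weight_def indicator_def)
  \<comment> \<open>Writing the indicator of the unit ball as 1 minus that of its complement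
    isolates the integrable factor \<open>iexp (\<xi> \<bullet> u) - 1\<close>.\<close>
  have "(\<integral>u. F' u \<partial>\<nu>) = (\<integral>u. \<i> * (of_real (\<eta> \<bullet> ((cos (\<xi> \<bullet> u) - 1) *\<^sub>R u)) + \<i> * of_real (\<eta> \<bullet> (sin (\<xi> \<bullet> u) *\<^sub>R u))
      + of_real (\<eta> \<bullet> (indicator {u. 1 < norm u} u *\<^sub>R u))) \<partial>\<nu>)"
    by (intro Bochner_Integration.integral_cong)
      (auto simp: F'_def iexp_eq_cos_sin indicator_def algebra_simps)
  also have "\<dots> = \<i> * (of_real (\<eta> \<bullet> cos_drift \<xi>) + \<i> * of_real (\<eta> \<bullet> sin_drift \<xi>)
      + of_real (\<eta> \<bullet> (LINT u:{u. 1 < norm u}|\<nu>. u)))"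
    unfolding cos_drift_def sin_drift_def set_lebesgue_integral_def
    using integrable_cos_drift[of \<xi>] integrable_sin_drift[of \<xi>] tail by (simp del: inner_scaleR_right)
  finally have F': "(\<integral>u. F' u \<partial>\<nu>) + \<i> * of_real (\<eta> \<bullet> drift) = d\<psi> \<xi> \<eta>"
    by (simp add: d\<psi>_def inner_diff_right inner_add_right algebra_simps)
  have \<psi>: "\<psi> \<zeta> = (\<integral>u. F \<zeta> u \<partial>\<nu>) + \<i> * of_real (\<zeta> \<bullet> drift)" for \<zeta>
    by (simp add: levy_khintchine_exponent_def F_def inner_commute)
  have "((\<lambda>h. complex_of_real ((\<xi> + h *\<^sub>R \<eta>) \<bullet> drift)) has_vector_derivative of_real (\<eta> \<bullet> drift)) (at 0)"
    unfolding inner_add_left inner_scaleR_left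
    by (rule has_vector_derivative_of_real) (auto intro!: derivative_eq_intros)
  then have "((\<lambda>h. (\<integral>u. F (\<xi> + h *\<^sub>R \<eta>) u \<partial>\<nu>) + \<i> * of_real ((\<xi> + h *\<^sub>R \<eta>) \<bullet> drift)) has_vector_derivative
      (\<integral>u. F' u \<partial>\<nu>) + \<i> * of_real (\<eta> \<bullet> drift)) (at 0)"
    by (intro has_vector_derivative_add D has_vector_derivative_mult_right)
  then show ?thesis unfolding \<psi> F' .
qed

section \<open>Equivalence with the Levy-Khintchine formula\<close>

text \<open>At fixed \<xi>, the real and imaginary parts of the complex equation are the inner
  products of \<eta> with the cosine and sine identities; letting \<eta> vary recovers the vector
  equations.\<close>

lemma stein_eq_characters_iff:
  "stein_eq (\<lambda>x. cos (\<xi> \<bullet> x)) \<and> stein_eq (\<lambda>x. sin (\<xi> \<bullet> x)) \<longleftrightarrow> (\<forall>\<eta>. d\<phi> \<xi> \<eta> = d\<psi> \<xi> \<eta> * \<phi> \<xi>)"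
proof -
  note I = integrable_comp[OF bounded_lipschitz_cos[of \<xi>]] integrable_comp[OF bounded_lipschitz_sin[of \<xi>]]
  define c where "c = (\<integral>\<omega>. cos (\<xi> \<bullet> X \<omega>) \<partial>M)"
  define s where "s = (\<integral>\<omega>. sin (\<xi> \<bullet> X \<omega>) \<partial>M)"
  define a where "a = (\<integral>\<omega>. cos (\<xi> \<bullet> X \<omega>) *\<^sub>R X \<omega> \<partial>M)"
  define b where "b = (\<integral>\<omega>. sin (\<xi> \<bullet> X \<omega>) *\<^sub>R X \<omega> \<partial>M)"
  have 1: "stein_eq (\<lambda>x. cos (\<xi> \<bullet> x)) \<longleftrightarrow> a = c *\<^sub>R mean + (c *\<^sub>R cos_drift \<xi> - s *\<^sub>R sin_drift \<xi>)"
    unfolding stein_eq_def jump_cos a_def c_def s_def using I by simp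
  have 2: "stein_eq (\<lambda>x. sin (\<xi> \<bullet> x)) \<longleftrightarrow> b = s *\<^sub>R mean + (s *\<^sub>R cos_drift \<xi> + c *\<^sub>R sin_drift \<xi>)"
    unfolding stein_eq_def jump_sin b_def c_def s_def using I by simp
  have 3: "d\<phi> \<xi> \<eta> = d\<psi> \<xi> \<eta> * \<phi> \<xi> \<longleftrightarrow> \<eta> \<bullet> a = \<eta> \<bullet> (c *\<^sub>R mean + (c *\<^sub>R cos_drift \<xi> - s *\<^sub>R sin_drift \<xi>))
      \<and> \<eta> \<bullet> b = \<eta> \<bullet> (s *\<^sub>R mean + (s *\<^sub>R cos_drift \<xi> + c *\<^sub>R sin_drift \<xi>))" for \<eta>
  proof -
    \<comment> \<open>After cancelling the common factor \<i>, complex multiplication yields exactly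
      the combinations found in \<open>jump_cos\<close> and \<open>jump_sin\<close>.\<close>
    have "d\<phi> \<xi> \<eta> = d\<psi> \<xi> \<eta> * \<phi> \<xi> \<longleftrightarrow>
        Complex (\<eta> \<bullet> a) (\<eta> \<bullet> b) = Complex (\<eta> \<bullet> (mean + cos_drift \<xi>)) (\<eta> \<bullet> sin_drift \<xi>) * Complex c s"
      unfolding d\<phi>_def d\<psi>_def phi_eq a_def[symmetric] b_def[symmetric] c_def[symmetric] s_def[symmetric]
      by (simp add: Complex_eq mult.assoc)
    then show ?thesis
      by (auto simp: complex_eq_iff inner_add_right inner_diff_right algebra_simps)
  qed
  show ?thesis
    unfolding 1 2 3 all_conj_distrib vector_eq_ldot ..
qed

text \<open>Multiplying by \<open>exp (- \<psi>)\<close> gives a function that is constant along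
  each ray. No logarithm of the characteristic function is taken, so its possible zeros raise no
  difficulty.\<close>

lemma phi_eq_exp_psi:
  assumes "\<And>\<xi> \<eta>. d\<phi> \<xi> \<eta> = d\<psi> \<xi> \<eta> * \<phi> \<xi>"
  shows "\<phi> \<xi> = exp (\<psi> \<xi>)"
proof -
  define G where "G t = \<phi> (t *\<^sub>R \<xi>) * exp (- \<psi> (t *\<^sub>R \<xi>))" for t
  have G': "(G has_vector_derivative 0) (at t)" for t
  proof -
    have 1: "((\<lambda>t. \<phi> (t *\<^sub>R \<xi>)) has_vector_derivative d\<phi> (t *\<^sub>R \<xi>) \<xi>) (at t)"
      by (rule has_vector_derivative_shift_at_0)
        (use phi_derivative[of "t *\<^sub>R \<xi>" \<xi>] in \<open>simp add: scaleR_add_left\<close>)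
    have "((\<lambda>t. \<psi> (t *\<^sub>R \<xi>)) has_vector_derivative d\<psi> (t *\<^sub>R \<xi>) \<xi>) (at t)"
      by (rule has_vector_derivative_shift_at_0)
        (use psi_derivative[of "t *\<^sub>R \<xi>" \<xi>] in \<open>simp add: scaleR_add_left\<close>)
    then have "((\<lambda>t. - \<psi> (t *\<^sub>R \<xi>)) has_vector_derivative - d\<psi> (t *\<^sub>R \<xi>) \<xi>) (at t)"
      by (rule has_vector_derivative_minus)
    from field_vector_diff_chain_at[OF this DERIV_exp]
    have "((\<lambda>t. exp (- \<psi> (t *\<^sub>R \<xi>))) has_vector_derivative
        - d\<psi> (t *\<^sub>R \<xi>) \<xi> * exp (- \<psi> (t *\<^sub>R \<xi>))) (at t)"
      by (simp add: comp_def)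
    from has_vector_derivative_mult[OF 1 this] show ?thesis
      unfolding G_def by (simp add: assms mult_ac)
  qed
  have "G 1 = G 0"
    by (rule has_derivative_zero_unique[OF convex_UNIV])
      (use G' in \<open>auto simp: has_vector_derivative_def\<close>)
  moreover have "G 0 = 1"
    by (simp add: G_def phi_eq prob_space levy_khintchine_exponent_def)
  ultimately have "G 1 = 1" by simp
  then show ?thesis by (simp add: G_def exp_minus field_simps)
qed

text \<open>The chain rule gives a second expression for the directional derivative, and derivatives
  are unique.\<close>

lemma derivative_of_phi_eq_exp_psi:
  assumes "\<And>\<xi>. \<phi> \<xi> = exp (\<psi> \<xi>)"
  shows "d\<phi> \<xi> \<eta> = d\<psi> \<xi> \<eta> * \<phi> \<xi>"
proof -
  have "((\<lambda>h. exp (\<psi> (\<xi> + h *\<^sub>R \<eta>))) has_vector_derivative d\<psi> \<xi> \<eta> * exp (\<psi> \<xi>)) (at 0)"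
    using field_vector_diff_chain_at[OF psi_derivative[of \<xi> \<eta>] DERIV_exp] by (simp add: comp_def)
  then show ?thesis
    using phi_derivative[of \<xi> \<eta>] vector_derivative_unique_at unfolding assms by blast
qed

lemma stein_iff_infinitely_divisible:
  "(\<forall>f. bounded (range f) \<and> (\<exists>L. L-lipschitz_on UNIV f) \<longrightarrow> stein_eq f)
    \<longleftrightarrow> infinitely_divisible_with_triplet M X drift 0 \<nu>"
proof
  assume st: "\<forall>f. bounded (range f) \<and> (\<exists>L. L-lipschitz_on UNIV f) \<longrightarrow> stein_eq f"
  have "stein_eq f" if "bounded_lipschitz B L f" for B L f
    using st that by (auto simp: bounded_lipschitz_def bounded_iff)
  from this[OF bounded_lipschitz_cos] this[OF bounded_lipschitz_sin]
  have "\<phi> \<xi> = exp (\<psi> \<xi>)" for \<xi>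
    by (intro phi_eq_exp_psi) (use stein_eq_characters_iff in blast)
  then show "infinitely_divisible_with_triplet M X drift 0 \<nu>"
    using levy by (simp add: infinitely_divisible_with_triplet_def transpose_def vec_eq_iff)
next
  assume "infinitely_divisible_with_triplet M X drift 0 \<nu>"
  then have "\<And>\<xi>. \<phi> \<xi> = exp (\<psi> \<xi>)" by (simp add: infinitely_divisible_with_triplet_def)
  then have cs: "stein_eq (\<lambda>x. cos (\<xi> \<bullet> x))" "stein_eq (\<lambda>x. sin (\<xi> \<bullet> x))" for \<xi>
    using stein_eq_characters_iff derivative_of_phi_eq_exp_psi by blast+
  show "\<forall>f. bounded (range f) \<and> (\<exists>L. L-lipschitz_on UNIV f) \<longrightarrow> stein_eq f"
  proof (intro allI impI, elim conjE exE)
    fix f :: "real ^ 'd \<Rightarrow> real" and L assume "bounded (range f)" "L-lipschitz_on UNIV f"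
    then obtain B where "bounded_lipschitz B L f"
      by (auto simp: bounded_lipschitz_def bounded_iff)
    then show "stein_eq f" by (rule stein_eq_bounded_lipschitz[OF cs])
  qed
qed

end

theorem theorem2p1:
  fixes M :: "'a measure"
    and X :: "'a \<Rightarrow> real ^ 'd::finite"
    and \<nu> :: "(real ^ 'd) measure"
  assumes "prob_space M"
    and "X \<in> borel_measurable M"
    and "\<And>i. integrable M (\<lambda>\<omega>. X \<omega> $ i)"
    and "levy_measure \<nu>"
    and "(\<integral>\<^sup>+ u \<in> {u. 1 \<le> norm u}. ennreal (norm u) \<partial>\<nu>) < \<infinity>"
  shows "(\<forall>f :: real ^ 'd \<Rightarrow> real. bounded (range f) \<and> (\<exists>L. L-lipschitz_on UNIV f) \<longrightarrow>
            (\<integral>\<omega>. f (X \<omega>) *\<^sub>R X \<omega> \<partial>M) =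
              (\<integral>\<omega>. f (X \<omega>) \<partial>M) *\<^sub>R (\<integral>\<omega>. X \<omega> \<partial>M) +
              (\<integral>\<omega>. (\<integral>u. (f (X \<omega> + u) - f (X \<omega>)) *\<^sub>R u \<partial>\<nu>) \<partial>M))
     \<longleftrightarrow> infinitely_divisible_with_triplet M X
           ((\<integral>\<omega>. X \<omega> \<partial>M) - (LINT u:{u. 1 < norm u}|\<nu>. u)) 0 \<nu>"
proof -
  \<comment> \<open>The assumption is coordinatewise; the Euclidean norm is at most the sum of the
    absolute coordinates, which gives integrability of the vector.\<close>
  have "integrable M X"
  proof (rule Bochner_Integration.integrable_bound)
    show "integrable M (\<lambda>\<omega>. \<Sum>i\<in>UNIV. \<bar>X \<omega> $ i\<bar>)" using assms(3) by simp
    show "AE \<omega> in M. norm (X \<omega>) \<le> norm (\<Sum>i\<in>UNIV. \<bar>X \<omega> $ i\<bar>)"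
      by (auto intro!: AE_I2 order_trans[OF norm_le_l1_cart] order_trans[OF _ abs_ge_self])
  qed (rule assms(2))
  then interpret stein M X \<nu>
    using assms by (intro stein.intro stein_axioms.intro)
  show ?thesis
    using stein_iff_infinitely_divisible unfolding stein_eq_def jump_def .
qed

end
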